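(* Let $\mathbf{O}=\{X_1,\dots,X_n\}$ be finitely many random variables, each with finitely many states, with joint distribution $p$, and let $\mathbf{D}$ be a data set of $m$ i.i.d. samples from $p$. Suppose that $p$ satisfies the composition property. Let $S$ be any locally consistent (and score equivalent) scoring criterion. Then, in the limit of large $m$, the unrestricted greedy equivalence search algorithm UGES run with $S$ on $\mathbf{D}$ (from any initial equivalence class) outputs an equivalence class of DAGs that is inclusion optimal for $p$; that is, the probability that the output of UGES is inclusion optimal for $p$ tends to $1$ as $m\to\infty$.
   Context: DAG models. A DAG $\mathcal{G}$ (directed acyclic graph) has node set $\mathbf{O}$; $\mathbf{Pa}_i^{\mathcal{G}}$ is the set of parents of $X_i$. $\mathcal{G}$ includes a distribution $p$ on $\mathbf{O}$ if $p$ factors as $p(x_1,\dots,x_n)=\prod_{i=1}^n p_i(x_i\mid \mathbf{pa}_i^{\mathcal{G}})$ for some (unrestricted, full-table) conditional distributions $p_i$; equivalently, in $p$ each $X_i$ is independent of its non-descendants given its parents. The independence constraints of $\mathcal{G}$ are those that hold in every distribution included in $\mathcal{G}$ (equivalently, given by d-separation). Write $\mathcal{G}\le\mathcal{H}$ if every distribution included in $\mathcal{G}$ is included in $\mathcal{H}$ (equivalently, every independence constraint of $\mathcal{H}$ is one of $\mathcal{G}$); $\mathcal{G}\approx\mathcal{H}$ if $\mathcal{G}\le\mathcal{H}$ and $\mathcal{H}\le\mathcal{G}$; $\mathcal{G}<\mathcal{H}$ if $\mathcal{G}\le\mathcal{H}$ and $\mathcal{G}\not\approx\mathcal{H}$.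 $\mathcal{E}(\mathcal{G})$ denotes the $\approx$-equivalence class of $\mathcal{G}$; all DAGs in a class have the same number of edges, and inclusion notions extend to classes via representatives. Inclusion optimality. $\mathcal{G}$ (or its class) is inclusion optimal for $p$ if $\mathcal{G}$ includes $p$ and there is no DAG $\mathcal{G}'$ with $\mathcal{G}'<\mathcal{G}$ that includes $p$. Composition property of $p$: for every variable $X\in\mathbf{O}$ and disjoint sets $\mathbf{Y},\mathbf{Z}\subseteq\mathbf{O}\setminus\{X\}$, if $X$ is not independent of $\mathbf{Y}$ given $\mathbf{Z}$ in $p$, then there is $Y\in\mathbf{Y}$ such that $X$ is not independent of $Y$ given $\mathbf{Z}$ in $p$. Scores. A scoring criterion is a real-valued function $S(\mathcal{G},\mathbf{D})$ of a DAG and a data set. It is score equivalent if $\mathcal{G}\approx\mathcal{H}$ implies $S(\mathcal{G},\mathbf{D})=S(\mathcal{H},\mathbf{D})$; the score of an equivalence class is then the common score of its members. "In the limit of large $m$" a property holds if it holds with probability tending to $1$ as $m\to\infty$. $S$ is locally consistent if, for data $\mathbf{D}$ of $m$ i.i.d. samples from a distribution $p$, and for every DAG $\mathcal{G}$ and every DAG $\mathcal{G}'$ obtained from $\mathcal{G}$ by adding an edge $X_j\to X_i$, in the limit of large $m$: (1) if $X_j$ is not independent of $X_i$ given $\mathbf{Pa}_i^{\mathcal{G}}$ in $p$, then $S(\mathcal{G}',\mathbf{D})>S(\mathcal{G},\mathbf{D})$; (2) if $X_j$ is independent of $X_i$ given $\mathbf{Pa}_i^{\mathcal{G}}$ in $p$,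 then $S(\mathcal{G}',\mathbf{D})<S(\mathcal{G},\mathbf{D})$. Search. States are equivalence classes of DAGs on $\mathbf{O}$. $\mathcal{E}(\mathcal{G})$ and $\mathcal{E}(\mathcal{G}')$ are adjacent if ($\mathcal{G}\le\mathcal{G}'$ or $\mathcal{G}'\le\mathcal{G}$) and the numbers of edges of $\mathcal{G}$ and $\mathcal{G}'$ differ by exactly one. UGES is the greedy search in which, at each step, all adjacent states (both those with $\mathcal{G}\le\mathcal{G}'$ and those with $\mathcal{G}'\le\mathcal{G}$) are considered: it repeatedly moves to a highest-scoring adjacent state, provided its score is strictly greater than the current one, and stops and outputs the current state when it is a local maximum (no adjacent state has a higher score). *)

theory Defs
  imports "HOL-Probability.Probability"
begin

text \<open>
  The random variables are indexed by a finite type \<open>'v\<close>. A joint state is a function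
  \<open>'v \<Rightarrow> 's\<close>; the variable \<open>i\<close> takes values in its own finite state set \<open>Val i\<close>.
  A directed graph on the variables is its edge relation, with \<open>(j, i)\<close> the edge from
  \<open>j\<close> to \<open>i\<close>, and it is a DAG if the relation is \<open>acyclic\<close>.
\<close>

definition parents :: "('v \<times> 'v) set \<Rightarrow> 'v \<Rightarrow> 'v set" where
  "parents G i = {j. (j, i) \<in> G}"

definition distribution_on :: "('v \<Rightarrow> 's set) \<Rightarrow> ('v \<Rightarrow> 's) pmf \<Rightarrow> bool" where
  "distribution_on Val p \<longleftrightarrow> set_pmf p \<subseteq> Pi UNIV Val"

text \<open>
  \<open>q i y\<close> is the conditional distribution of variable \<open>i\<close> given the parent configuration
  \<open>y\<close>. It depends on the joint state \<open>x\<close> only through the restriction of \<open>x\<close> to the parents.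
\<close>

definition dag_includes :: "('v::finite \<times> 'v) set \<Rightarrow> ('v \<Rightarrow> 's) pmf \<Rightarrow> bool" where
  "dag_includes G p \<longleftrightarrow>
     (\<exists>q :: 'v \<Rightarrow> ('v \<Rightarrow> 's) \<Rightarrow> 's pmf.
        \<forall>x. pmf p x = (\<Prod>i\<in>UNIV. pmf (q i (restrict x (parents G i))) (x i)))"

text \<open>
  The order ranges over all joint distributions of finite-valued variables, with arbitrary
  numbers of states: up to renaming of states, these are the finitely supported
  distributions on \<open>'v \<Rightarrow> nat\<close>. So it depends on the graphs alone, not on the
  state sets of a particular distribution.
\<close>

definition dag_le :: "('v::finite \<times> 'v) set \<Rightarrow> ('v \<times> 'v) set \<Rightarrow> bool" where
  "dag_le G H \<longleftrightarrow>
     (\<forall>p :: ('v \<Rightarrow> nat) pmf. finite (set_pmf p) \<longrightarrow> dag_includes G p \<longrightarrow> dag_includes H p)"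

definition dag_equiv :: "('v::finite \<times> 'v) set \<Rightarrow> ('v \<times> 'v) set \<Rightarrow> bool" where
  "dag_equiv G H \<longleftrightarrow> dag_le G H \<and> dag_le H G"

definition dag_less :: "('v::finite \<times> 'v) set \<Rightarrow> ('v \<times> 'v) set \<Rightarrow> bool" where
  "dag_less G H \<longleftrightarrow> dag_le G H \<and> \<not> dag_equiv G H"

definition dag_classes :: "('v::finite \<times> 'v) set set set" where
  "dag_classes = {G. acyclic G} // {(G, H). acyclic G \<and> acyclic H \<and> dag_equiv G H}"

definition inclusion_optimal :: "('v::finite \<Rightarrow> 's) pmf \<Rightarrow> ('v \<times> 'v) set \<Rightarrow> bool" where
  "inclusion_optimal p G \<longleftrightarrow>
     acyclic G \<and> dag_includes G p \<and> \<not> (\<exists>G'. acyclic G' \<and> dag_less G' G \<and> dag_includes G' p)"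

definition class_inclusion_optimal ::
    "('v::finite \<Rightarrow> 's) pmf \<Rightarrow> ('v \<times> 'v) set set \<Rightarrow> bool" where
  "class_inclusion_optimal p c \<longleftrightarrow> c \<in> dag_classes \<and> (\<forall>G\<in>c. inclusion_optimal p G)"

text \<open>
  Independence of the variables in \<open>A\<close> from those in \<open>B\<close> given those in \<open>C\<close>: for every
  configuration of \<open>C\<close> of positive probability, independence under \<open>p\<close> conditioned on it.
\<close>

definition cond_indep :: "('v \<Rightarrow> 's) pmf \<Rightarrow> 'v set \<Rightarrow> 'v set \<Rightarrow> 'v set \<Rightarrow> bool" where
  "cond_indep p A B C \<longleftrightarrow>
     (\<forall>z\<in>set_pmf p.
        prob_space.indep_var (measure_pmf (cond_pmf p {x. restrict x C = restrict z C}))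
          (count_space UNIV) (\<lambda>x. restrict x A) (count_space UNIV) (\<lambda>x. restrict x B))"

definition composition_property :: "('v \<Rightarrow> 's) pmf \<Rightarrow> bool" where
  "composition_property p \<longleftrightarrow>
     (\<forall>X Y Z. X \<notin> Y \<longrightarrow> X \<notin> Z \<longrightarrow> Y \<inter> Z = {} \<longrightarrow> \<not> cond_indep p {X} Y Z \<longrightarrow>
        (\<exists>y\<in>Y. \<not> cond_indep p {X} {y} Z))"

text \<open>
  The data set of size \<open>m\<close> is the list of \<open>m\<close> independent draws from \<open>p\<close>.
\<close>

definition in_large_sample_limit :: "'a pmf \<Rightarrow> ('a list \<Rightarrow> bool) \<Rightarrow> bool" where
  "in_large_sample_limit p P \<longleftrightarrow>
     (\<lambda>m. measure_pmf.prob (replicate_pmf m p) {D. P D}) \<longlonglongrightarrow> 1"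

type_synonym ('v, 's) score = "('v \<times> 'v) set \<Rightarrow> ('v \<Rightarrow> 's) list \<Rightarrow> real"

definition score_equivalent :: "('v::finite \<Rightarrow> 's set) \<Rightarrow> ('v, 's) score \<Rightarrow> bool" where
  "score_equivalent Val S \<longleftrightarrow>
     (\<forall>G H. acyclic G \<longrightarrow> acyclic H \<longrightarrow> dag_equiv G H \<longrightarrow>
        (\<forall>D\<in>lists (Pi UNIV Val). S G D = S H D))"

definition locally_consistent :: "('v::finite \<Rightarrow> 's set) \<Rightarrow> ('v, 's) score \<Rightarrow> bool" where
  "locally_consistent Val S \<longleftrightarrow>
     (\<forall>p. distribution_on Val p \<longrightarrow>
       (\<forall>G j i. acyclic G \<longrightarrow> (j, i) \<notin> G \<longrightarrow> acyclic (insert (j, i) G) \<longrightarrow>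
          (\<not> cond_indep p {j} {i} (parents G i) \<longrightarrow>
             in_large_sample_limit p (\<lambda>D. S (insert (j, i) G) D > S G D)) \<and>
          (cond_indep p {j} {i} (parents G i) \<longrightarrow>
             in_large_sample_limit p (\<lambda>D. S (insert (j, i) G) D < S G D))))"

text \<open>
  The common score of the members of a class (well defined for score equivalent \<open>S\<close>).
\<close>

definition class_score ::
    "('v, 's) score \<Rightarrow> ('v \<Rightarrow> 's) list \<Rightarrow> ('v \<times> 'v) set set \<Rightarrow> real" where
  "class_score S D c = the_elem ((\<lambda>G. S G D) ` c)"

definition adjacent_classes ::
    "('v::finite \<times> 'v) set set \<Rightarrow> ('v \<times> 'v) set set \<Rightarrow> bool" where
  "adjacent_classes c c' \<longleftrightarrow>
     c \<in> dag_classes \<and> c' \<in> dag_classes \<and>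
     (\<exists>G\<in>c. \<exists>G'\<in>c'. (dag_le G G' \<or> dag_le G' G) \<and>
        (card G' = card G + 1 \<or> card G = card G' + 1))"

text \<open>
  Ties between highest-scoring neighbours may be broken in any way, so a step is a relation.
\<close>

definition uges_step :: "('v::finite, 's) score \<Rightarrow> ('v \<Rightarrow> 's) list \<Rightarrow>
    ('v \<times> 'v) set set \<Rightarrow> ('v \<times> 'v) set set \<Rightarrow> bool" where
  "uges_step S D c c' \<longleftrightarrow>
     adjacent_classes c c' \<and> class_score S D c < class_score S D c' \<and>
     (\<forall>d. adjacent_classes c d \<longrightarrow> class_score S D d \<le> class_score S D c')"

definition local_maximum ::
    "('v::finite, 's) score \<Rightarrow> ('v \<Rightarrow> 's) list \<Rightarrow> ('v \<times> 'v) set set \<Rightarrow> bool" where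
  "local_maximum S D c \<longleftrightarrow>
     (\<forall>d. adjacent_classes c d \<longrightarrow> class_score S D d \<le> class_score S D c)"

definition uges_output :: "('v::finite, 's) score \<Rightarrow> ('v \<Rightarrow> 's) list \<Rightarrow>
    ('v \<times> 'v) set set \<Rightarrow> ('v \<times> 'v) set set \<Rightarrow> bool" where
  "uges_output S D c0 c \<longleftrightarrow> rtranclp (uges_step S D) c0 c \<and> local_maximum S D c"

end

theory Submission
  imports Defs
begin

text \<open>
  If a local maximum \<open>G\<close> does not include \<open>p\<close>, the ordered Markov property fails at some
  variable, by composition it fails for a single predecessor, and adding the corresponding
  edge raises the score. If \<open>G\<close> includes \<open>p\<close> but some \<open>G' < G\<close> does too, then (Meek's
  conjecture) \<open>G' \<le> K\<close> for some \<open>K\<close> obtained by deleting an edge from a DAG equivalent to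
  \<open>G\<close>; as \<open>K\<close> includes \<open>p\<close>, the deletion raises the score.

  Meek's conjecture is proved without d-separation. Take \<open>G \<le> H\<close> such that no edge can
  be added to a DAG equivalent to \<open>G\<close> while staying below \<open>H\<close>, and let \<open>Y\<close> be the last
  variable of \<open>H\<close> at which the two differ. With Chickering's choice of a child \<open>Z\<close> of \<open>Y\<close>,
  the edge \<open>Y \<rightarrow> Z\<close> is covered: otherwise an edge \<open>X \<rightarrow> Z\<close> or \<open>X \<rightarrow> Y\<close> could be added.
  That the enlarged model stays below \<open>H\<close> follows by simulating a distribution \<open>p\<close> of it by
  a distribution of \<open>G\<close> with more states, whose independences given by \<open>H\<close> descend to \<open>p\<close>.
  Reversing covered edges turns \<open>Y\<close> into a sink with the same parents as in \<open>H\<close>.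
\<close>

section \<open>Conditional independence of functions on a probability mass function\<close>

text \<open>Discrete form of "\<open>g\<close> is almost surely a function of \<open>f\<close>":
  only the support counts, so dependencies that hold by the construction of \<open>p\<close> may be
  used.\<close>

definition determines :: "'a pmf \<Rightarrow> ('a \<Rightarrow> 'b) \<Rightarrow> ('a \<Rightarrow> 'c) \<Rightarrow> bool" where
  "determines p f g \<longleftrightarrow> (\<forall>x\<in>set_pmf p. \<forall>y\<in>set_pmf p. f x = f y \<longrightarrow> g x = g y)"

lemma determinesI:
  "(\<And>x y. x \<in> set_pmf p \<Longrightarrow> y \<in> set_pmf p \<Longrightarrow> f x = f y \<Longrightarrow> g x = g y) \<Longrightarrow> determines p f g"
  unfolding determines_def by blast

lemma determinesD:
  "determines p f g \<Longrightarrow> x \<in> set_pmf p \<Longrightarrow> y \<in> set_pmf p \<Longrightarrow> f x = f y \<Longrightarrow> g x = g y"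
  unfolding determines_def by blast

text \<open>
  Stating independence with events \<open>A\<close>, \<open>B\<close> rather than values of \<open>f\<close>, \<open>g\<close> makes replacing
  \<open>f\<close> by a function of \<open>f\<close> and \<open>h\<close> a matter of preimages, without summation.
\<close>

definition ci :: "'a pmf \<Rightarrow> ('a \<Rightarrow> 'b) \<Rightarrow> ('a \<Rightarrow> 'c) \<Rightarrow> ('a \<Rightarrow> 'd) \<Rightarrow> bool" where
  "ci p f g h \<longleftrightarrow> (\<forall>A B c.
     measure_pmf.prob p {x. f x \<in> A \<and> g x \<in> B \<and> h x = c} * measure_pmf.prob p {x. h x = c} =
     measure_pmf.prob p {x. f x \<in> A \<and> h x = c} * measure_pmf.prob p {x. g x \<in> B \<and> h x = c})"

lemma prob_cong_supp:
  assumes "\<And>x. x \<in> set_pmf p \<Longrightarrow> P x \<longleftrightarrow> Q x"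
  shows "measure_pmf.prob p {x. P x} = measure_pmf.prob p {x. Q x}"
proof -
  have "{x. P x} \<inter> set_pmf p = {x. Q x} \<inter> set_pmf p"
    using assms by blast
  then show ?thesis
    by (metis measure_Int_set_pmf)
qed

lemma prob_le:
  assumes "\<And>x. P x \<Longrightarrow> Q x"
  shows "measure_pmf.prob p {x. P x} \<le> measure_pmf.prob p {x. Q x}"
  by (rule measure_pmf.finite_measure_mono) (use assms in auto)

lemma prob_eq_0_mono:
  assumes "measure_pmf.prob p {x. Q x} = 0" "\<And>x. P x \<Longrightarrow> Q x"
  shows "measure_pmf.prob p {x. P x} = 0"
  using prob_le[of P Q p] assms by (simp add: measure_le_0_iff)

lemma ciD:
  "ci p f g h \<Longrightarrow>
     measure_pmf.prob p {x. f x \<in> A \<and> g x \<in> B \<and> h x = c} * measure_pmf.prob p {x. h x = c} =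
     measure_pmf.prob p {x. f x \<in> A \<and> h x = c} * measure_pmf.prob p {x. g x \<in> B \<and> h x = c}"
  by (simp add: ci_def)

section \<open>Graphoid rules for conditional independence\<close>

lemma ci_sym:
  assumes "ci p f g h"
  shows "ci p g f h"
  unfolding ci_def
proof (intro allI)
  fix A B c
  have "{x. g x \<in> A \<and> f x \<in> B \<and> h x = c} = {x. f x \<in> B \<and> g x \<in> A \<and> h x = c}"
    by blast
  then show "measure_pmf.prob p {x. g x \<in> A \<and> f x \<in> B \<and> h x = c} * measure_pmf.prob p {x. h x = c} =
     measure_pmf.prob p {x. g x \<in> A \<and> h x = c} * measure_pmf.prob p {x. f x \<in> B \<and> h x = c}"
    using ciD[OF assms, of B A c] by (simp only: mult.commute)
qed

text \<open>Decomposition, where \<open>f'\<close> may also read the conditioning value: on a fibre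
  of \<open>h\<close> an event about \<open>f'\<close> is an event about \<open>f\<close>.\<close>

lemma ci_left:
  assumes "ci p f g h" and det: "determines p (\<lambda>x. (f x, h x)) f'"
  shows "ci p f' g h"
  unfolding ci_def
proof (intro allI)
  fix A B c
  define A' where "A' = f ` {x \<in> set_pmf p. f' x \<in> A \<and> h x = c}"
  have *: "f' x \<in> A \<longleftrightarrow> f x \<in> A'" if "x \<in> set_pmf p" "h x = c" for x
  proof
    assume "f x \<in> A'"
    then obtain y where y: "y \<in> set_pmf p" "f' y \<in> A" "h y = c" "f x = f y" by (auto simp: A'_def)
    have "f' x = f' y" by (rule determinesD[OF det \<open>x \<in> set_pmf p\<close> y(1)]) (simp add: y that)
    then show "f' x \<in> A" using y by simp
  qed (use that in \<open>auto simp: A'_def\<close>)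
  have 1: "measure_pmf.prob p {x. f' x \<in> A \<and> g x \<in> B \<and> h x = c} =
      measure_pmf.prob p {x. f x \<in> A' \<and> g x \<in> B \<and> h x = c}"
    by (rule prob_cong_supp) (use * in auto)
  have 2: "measure_pmf.prob p {x. f' x \<in> A \<and> h x = c} =
      measure_pmf.prob p {x. f x \<in> A' \<and> h x = c}"
    by (rule prob_cong_supp) (use * in auto)
  show "measure_pmf.prob p {x. f' x \<in> A \<and> g x \<in> B \<and> h x = c} * measure_pmf.prob p {x. h x = c} =
     measure_pmf.prob p {x. f' x \<in> A \<and> h x = c} * measure_pmf.prob p {x. g x \<in> B \<and> h x = c}"
    unfolding 1 2 by (rule ciD[OF assms(1)])
qed

lemma ci_right:
  assumes "ci p f g h" and "determines p (\<lambda>x. (g x, h x)) g'"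
  shows "ci p f g' h"
  by (rule ci_sym, rule ci_left, rule ci_sym, rule assms(1), rule assms(2))

text \<open>Weak union, for any \<open>h'\<close> between \<open>h\<close> and the pair
  \<open>(g, h)\<close>. On the support, a fibre of \<open>h'\<close> is a fibre of \<open>h\<close>
  cut down by a condition \<open>B0\<close> on \<open>g\<close>, so the hypothesis is used twice,
  for \<open>B \<inter> B0\<close> and for \<open>B0\<close>.\<close>

lemma ci_weak_union:
  assumes ci: "ci p f g h" and h': "determines p (\<lambda>x. (g x, h x)) h'" and h: "determines p h' h"
  shows "ci p f g h'"
  unfolding ci_def
proof (intro allI)
  fix A B c'
  show "measure_pmf.prob p {x. f x \<in> A \<and> g x \<in> B \<and> h' x = c'} * measure_pmf.prob p {x. h' x = c'} =
     measure_pmf.prob p {x. f x \<in> A \<and> h' x = c'} * measure_pmf.prob p {x. g x \<in> B \<and> h' x = c'}"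
  proof (cases "\<exists>x\<in>set_pmf p. h' x = c'")
    case False
    then have "measure_pmf.prob p {x. h' x = c'} = measure_pmf.prob p {x. False}"
      by (intro prob_cong_supp) auto
    then have z: "measure_pmf.prob p {x. h' x = c'} = 0" by simp
    show ?thesis using prob_eq_0_mono[OF z, of "\<lambda>x. f x \<in> A \<and> h' x = c'"] z by simp
  next
    case True
    then obtain x0 where x0: "x0 \<in> set_pmf p" "h' x0 = c'" by blast
    define c where "c = h x0"
    define B0 where "B0 = g ` {x \<in> set_pmf p. h' x = c'}"
    have *: "h' x = c' \<longleftrightarrow> g x \<in> B0 \<and> h x = c" if "x \<in> set_pmf p" for x
    proof
      assume "h' x = c'"
      then show "g x \<in> B0 \<and> h x = c"
        using determinesD[OF h that x0(1)] that x0(2) unfolding B0_def c_def by simp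
    next
      assume a: "g x \<in> B0 \<and> h x = c"
      then obtain y where y: "y \<in> set_pmf p" "h' y = c'" "g x = g y" by (auto simp: B0_def)
      then have "h y = c" using determinesD[OF h y(1) x0(1)] x0(2) unfolding c_def by simp
      then show "h' x = c'" using determinesD[OF h' that y(1)] y(2,3) a by simp
    qed
    let ?P = "measure_pmf.prob p"
    have e1: "?P {x. f x \<in> A \<and> g x \<in> B \<and> h' x = c'} = ?P {x. f x \<in> A \<and> g x \<in> B \<inter> B0 \<and> h x = c}"
      by (rule prob_cong_supp) (use * in auto)
    have e2: "?P {x. h' x = c'} = ?P {x. g x \<in> B0 \<and> h x = c}"
      by (rule prob_cong_supp) (use * in auto)
    have e3: "?P {x. f x \<in> A \<and> h' x = c'} = ?P {x. f x \<in> A \<and> g x \<in> B0 \<and> h x = c}"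
      by (rule prob_cong_supp) (use * in auto)
    have e4: "?P {x. g x \<in> B \<and> h' x = c'} = ?P {x. g x \<in> B \<inter> B0 \<and> h x = c}"
      by (rule prob_cong_supp) (use * in auto)
    note i = ciD[OF ci, of A "B \<inter> B0" c] ciD[OF ci, of A B0 c]
    show ?thesis
    proof (cases "?P {x. h x = c} = 0")
      case True
      then show ?thesis unfolding e1 e2 e3 e4
        using prob_eq_0_mono[OF True, of "\<lambda>x. f x \<in> A \<and> g x \<in> B \<inter> B0 \<and> h x = c"]
          prob_eq_0_mono[OF True, of "\<lambda>x. g x \<in> B \<inter> B0 \<and> h x = c"] by simp
    next
      case False
      let ?X = "?P {x. f x \<in> A \<and> g x \<in> B \<inter> B0 \<and> h x = c}" and ?Y = "?P {x. g x \<in> B0 \<and> h x = c}"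
        and ?U = "?P {x. f x \<in> A \<and> g x \<in> B0 \<and> h x = c}" and ?W = "?P {x. g x \<in> B \<inter> B0 \<and> h x = c}"
        and ?F = "?P {x. f x \<in> A \<and> h x = c}" and ?H = "?P {x. h x = c}"
      \<comment> \<open>Multiplying by the mass of the fibre of \<open>h\<close> makes both
        instances applicable; this factor is nonzero here and is cancelled at the end.\<close>
      have "?X * ?Y * ?H = (?X * ?H) * ?Y" by simp
      also have "\<dots> = (?F * ?Y) * ?W" unfolding i by simp
      also have "\<dots> = ?U * ?W * ?H" unfolding i(2)[symmetric] by simp
      finally have "?X * ?Y * ?H = ?U * ?W * ?H" .
      then show ?thesis unfolding e1 e2 e3 e4 using False by simp
    qed
  qed
qed

text \<open>Contraction. Finite support turns an event about \<open>(g, e)\<close> into a finite sum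
  over the values \<open>b\<close> of \<open>g\<close>; for each of them the two hypotheses combine
  once the mass of \<open>(g, h) = (b, c)\<close> is cancelled.\<close>

lemma ci_contraction:
  assumes fin: "finite (set_pmf p)"
    and fg: "ci p f g h" and fe: "ci p f e (\<lambda>x. (g x, h x))"
  shows "ci p f (\<lambda>x. (g x, e x)) h"
  unfolding ci_def
proof (intro allI)
  fix A B c
  let ?P = "measure_pmf.prob p"
  let ?I = "g ` set_pmf p"
  have split: "?P {x. Q x} = (\<Sum>b\<in>?I. ?P {x. Q x \<and> g x = b})" for Q
  proof -
    have "?P {x. Q x} = ?P (\<Union>b\<in>?I. {x. Q x \<and> g x = b})"
      by (rule measure_prob_cong_0) (auto simp: set_pmf_iff)
    also have "\<dots> = (\<Sum>b\<in>?I. ?P {x. Q x \<and> g x = b})"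
      by (rule measure_pmf.finite_measure_finite_Union) (use fin in \<open>auto simp: disjoint_family_on_def\<close>)
    finally show ?thesis .
  qed
  have "?P {x. (f x \<in> A \<and> (g x, e x) \<in> B \<and> h x = c) \<and> g x = b} * ?P {x. h x = c} =
     ?P {x. f x \<in> A \<and> h x = c} * ?P {x. ((g x, e x) \<in> B \<and> h x = c) \<and> g x = b}" for b
  proof (cases "?P {x. g x = b \<and> h x = c} = 0")
    case True
    show ?thesis
      using prob_eq_0_mono[OF True, of "\<lambda>x. (f x \<in> A \<and> (g x, e x) \<in> B \<and> h x = c) \<and> g x = b"]
        prob_eq_0_mono[OF True, of "\<lambda>x. ((g x, e x) \<in> B \<and> h x = c) \<and> g x = b"] by simp
  next
    case False
    define Bb where "Bb = {y. (b, y) \<in> B}"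
    let ?X = "?P {x. f x \<in> A \<and> e x \<in> Bb \<and> (g x, h x) = (b, c)}" and ?G = "?P {x. (g x, h x) = (b, c)}"
      and ?FG = "?P {x. f x \<in> A \<and> (g x, h x) = (b, c)}" and ?E = "?P {x. e x \<in> Bb \<and> (g x, h x) = (b, c)}"
      and ?F = "?P {x. f x \<in> A \<and> h x = c}" and ?H = "?P {x. h x = c}"
    have 1: "?X * ?G = ?FG * ?E" by (rule ciD[OF fe])
    have 2: "?FG * ?H = ?F * ?G"
      using ciD[OF fg, of A "{b}" c] by simp
    have "?X * ?H * ?G = ?F * ?E * ?G"
      using 1 2 by algebra
    moreover have "?G \<noteq> 0" using False by simp
    ultimately have "?X * ?H = ?F * ?E" by simp
    moreover have "{x. (f x \<in> A \<and> (g x, e x) \<in> B \<and> h x = c) \<and> g x = b} =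
        {x. f x \<in> A \<and> e x \<in> Bb \<and> (g x, h x) = (b, c)}"
      "{x. ((g x, e x) \<in> B \<and> h x = c) \<and> g x = b} = {x. e x \<in> Bb \<and> (g x, h x) = (b, c)}"
      by (auto simp: Bb_def)
    ultimately show ?thesis by simp
  qed
  then show "?P {x. f x \<in> A \<and> (g x, e x) \<in> B \<and> h x = c} * ?P {x. h x = c} =
     ?P {x. f x \<in> A \<and> h x = c} * ?P {x. (g x, e x) \<in> B \<and> h x = c}"
    unfolding split[of "\<lambda>x. f x \<in> A \<and> (g x, e x) \<in> B \<and> h x = c"]
      split[of "\<lambda>x. (g x, e x) \<in> B \<and> h x = c"]
    by (simp add: sum_distrib_left sum_distrib_right)
qed

text \<open>The rule by which independence is moved between distributions: combined with
  \<open>ci_map_pmf\<close>, it reduces every such transfer to four checks of functional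
  dependence.\<close>

lemma ci_map:
  assumes ci: "ci p f g h"
    and h': "determines p (\<lambda>x. (g x, h x)) h'" and h: "determines p h' h"
    and f': "determines p (\<lambda>x. (f x, h' x)) f'" and g': "determines p (\<lambda>x. (g x, h' x)) g'"
  shows "ci p f' g' h'"
proof -
  have "ci p f g h'" by (rule ci_weak_union[OF ci h' h])
  then have "ci p f' g h'" by (rule ci_left) (rule f')
  then show ?thesis by (rule ci_right) (rule g')
qed

text \<open>A constant is independent of everything, and \<open>ci_left\<close> turns the constant
  into any function of \<open>h\<close>.\<close>

lemma ci_trivial: "determines p h f \<Longrightarrow> ci p f g h"
proof -
  assume det: "determines p h f"
  have "ci p (\<lambda>_. ()) g h"
    unfolding ci_def
  proof (intro allI)
    fix A :: "unit set" and B c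
    show "measure_pmf.prob p {x. () \<in> A \<and> g x \<in> B \<and> h x = c} * measure_pmf.prob p {x. h x = c} =
       measure_pmf.prob p {x. () \<in> A \<and> h x = c} * measure_pmf.prob p {x. g x \<in> B \<and> h x = c}"
      by (cases "() \<in> A") simp_all
  qed
  then show ?thesis
    by (rule ci_left) (use determinesD[OF det] in \<open>blast intro: determinesI\<close>)
qed

lemma ci_map_pmf: "ci (map_pmf \<phi> p) f g h \<longleftrightarrow> ci p (f \<circ> \<phi>) (g \<circ> \<phi>) (h \<circ> \<phi>)"
  by (simp add: ci_def vimage_def o_def)

text \<open>The basic source of independence: a fresh draw whose law depends on \<open>x\<close>
  only through \<open>h x\<close>. On the fibre of \<open>c\<close> joint probabilities factor with
  first factor \<open>K c A\<close>, and four instances of this give the claim.\<close>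

lemma ci_kernel:
  "ci (bind_pmf p (\<lambda>x. map_pmf (Pair x) (K (h x)))) snd fst (h \<circ> fst)"
  unfolding ci_def
proof (intro allI)
  fix A B c
  let ?q = "bind_pmf p (\<lambda>x. map_pmf (Pair x) (K (h x)))"
  have *: "measure_pmf.prob ?q {x. snd x \<in> A \<and> fst x \<in> B \<and> (h \<circ> fst) x = c} =
      measure_pmf.prob (K c) A * measure_pmf.prob p {x. x \<in> B \<and> h x = c}" for A B
  proof -
    have "emeasure (measure_pmf ?q) {x. snd x \<in> A \<and> fst x \<in> B \<and> (h \<circ> fst) x = c} =
      (\<integral>\<^sup>+x. emeasure (K (h x)) (Pair x -` {x. snd x \<in> A \<and> fst x \<in> B \<and> (h \<circ> fst) x = c}) \<partial>p)"
      by simp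
    also have "\<dots> = (\<integral>\<^sup>+x. emeasure (K c) A * indicator {x. x \<in> B \<and> h x = c} x \<partial>p)"
      by (intro nn_integral_cong) (auto simp: indicator_def vimage_def)
    also have "\<dots> = emeasure (K c) A * emeasure p {x. x \<in> B \<and> h x = c}"
      by (rule nn_integral_cmult_indicator) simp
    finally show ?thesis
      by (simp add: measure_pmf.emeasure_eq_measure ennreal_mult[symmetric] measure_nonneg)
  qed
  have full: "measure_pmf.prob (K c) UNIV = 1" by simp
  show "measure_pmf.prob ?q {x. snd x \<in> A \<and> fst x \<in> B \<and> (h \<circ> fst) x = c} *
      measure_pmf.prob ?q {x. (h \<circ> fst) x = c} =
      measure_pmf.prob ?q {x. snd x \<in> A \<and> (h \<circ> fst) x = c} *
      measure_pmf.prob ?q {x. fst x \<in> B \<and> (h \<circ> fst) x = c}"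
    using *[of A B] *[of UNIV UNIV] *[of A UNIV] *[of UNIV B] full by simp
qed

section \<open>Factorization and the ordered Markov property\<close>

lemma restrict_eq_iff: "restrict x A = restrict y A \<longleftrightarrow> (\<forall>a\<in>A. x a = y a)"
  by (auto simp: restrict_def fun_eq_iff)

section \<open>Topological lists and ancestral sampling\<close>

definition ancestral :: "('v \<times> 'v) set \<Rightarrow> 'v set \<Rightarrow> bool" where
  "ancestral G A \<longleftrightarrow> (\<forall>(u, v)\<in>G. v \<in> A \<longrightarrow> u \<in> A)"

lemma ancestralD: "ancestral G A \<Longrightarrow> v \<in> A \<Longrightarrow> parents G v \<subseteq> A"
  by (auto simp: ancestral_def parents_def)

text \<open>A reversed topological order: the head comes last, so lists grow by putting later
  variables in front.\<close>

primrec topo :: "('v \<times> 'v) set \<Rightarrow> 'v list \<Rightarrow> bool" where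
  "topo G [] \<longleftrightarrow> True"
| "topo G (v # vs) \<longleftrightarrow> v \<notin> set vs \<and> parents G v \<subseteq> set vs \<and> topo G vs"

lemma topo_parents: "topo G vs \<Longrightarrow> v \<in> set vs \<Longrightarrow> parents G v \<subseteq> set vs"
  by (induction vs) auto

text \<open>A minimal missing variable is prepended; its parents are listed already because
  \<open>B\<close> is ancestral. The free choice of \<open>vs\<close> makes it possible to list an
  ancestral set first and a chosen variable next.\<close>

lemma topo_extend:
  fixes G :: "('v::finite \<times> 'v) set"
  assumes "acyclic G" "topo G vs" "set vs \<subseteq> B" "ancestral G B"
  shows "\<exists>us. topo G (us @ vs) \<and> set (us @ vs) = B"
  using assms(2,3)
proof (induction "card (B - set vs)" arbitrary: vs)
  case 0
  then have "B - set vs = {}" by simp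
  then show ?case using 0 by (intro exI[of _ "[]"]) auto
next
  case (Suc n)
  have "wf G" using assms(1) by (intro finite_acyclic_wf) auto
  moreover obtain b where "b \<in> B - set vs" using Suc.hyps(2) by (metis card.empty equals0I nat.distinct(1))
  ultimately obtain v where v: "v \<in> B - set vs" "\<And>u. (u, v) \<in> G \<Longrightarrow> u \<notin> B - set vs"
    by (metis wfE_min)
  have p: "parents G v \<subseteq> set vs"
    using v ancestralD[OF assms(4), of v] by (auto simp: parents_def)
  have "\<exists>us. topo G (us @ v # vs) \<and> set (us @ v # vs) = B"
  proof (rule Suc.hyps(1))
    have "B - set (v # vs) = (B - set vs) - {v}" by auto
    then show "n = card (B - set (v # vs))" using Suc.hyps(2) v by simp
  qed (use Suc.prems v p in auto)
  then obtain us where "topo G (us @ v # vs) \<and> set (us @ v # vs) = B" by blast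
  then show ?case by (intro exI[of _ "us @ [v]"]) auto
qed

text \<open>Ancestral sampling along a \<open>topo\<close> list. Coordinates not drawn yet stay
  \<open>undefined\<close>, as under \<open>restrict\<close>, so marginals on the earlier variables
  are literally shorter samples.\<close>

primrec sample :: "('v \<Rightarrow> ('v \<Rightarrow> 's) \<Rightarrow> 's pmf) \<Rightarrow> 'v list \<Rightarrow> ('v \<Rightarrow> 's) pmf" where
  "sample K [] = return_pmf (\<lambda>_. undefined)"
| "sample K (v # vs) = bind_pmf (sample K vs) (\<lambda>x. map_pmf (\<lambda>a. x(v := a)) (K v x))"

lemma sample_undefined:
  "x \<in> set_pmf (sample K vs) \<Longrightarrow> v \<notin> set vs \<Longrightarrow> x v = undefined"
  by (induction vs arbitrary: x) auto

lemma finite_sample: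
  assumes "\<And>v x. finite (set_pmf (K v x))"
  shows "finite (set_pmf (sample K vs))"
  by (induction vs) (use assms in auto)

lemma map_restrict_sample:
  assumes "topo G (us @ vs)"
  shows "map_pmf (\<lambda>x. restrict x (set vs)) (sample K (us @ vs)) = sample K vs"
  using assms
proof (induction us)
  case Nil
  have "map_pmf (\<lambda>x. restrict x (set vs)) (sample K vs) = map_pmf (\<lambda>x. x) (sample K vs)"
  proof (rule map_pmf_cong[OF refl])
    fix x assume "x \<in> set_pmf (sample K vs)"
    then show "restrict x (set vs) = x"
      using sample_undefined[of x K vs] by (auto simp: restrict_def fun_eq_iff)
  qed
  then show ?case by (simp only: append_Nil pmf.map_ident)
next
  case (Cons u us)
  have r: "(\<lambda>x. restrict x (set vs)) \<circ> (\<lambda>a. x(u := a)) = (\<lambda>_. restrict x (set vs))" for x :: "_ \<Rightarrow> 'b"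
    using Cons.prems by (auto simp: restrict_def fun_eq_iff)
  have "map_pmf (\<lambda>x. restrict x (set vs)) (sample K ((u # us) @ vs)) =
      map_pmf (\<lambda>x. restrict x (set vs)) (sample K (us @ vs))"
    unfolding map_pmf_def[of "\<lambda>x. restrict x (set vs)"  "sample K (us @ vs)"]
    by (simp add: map_bind_pmf pmf.map_comp r)
  also have "\<dots> = sample K vs"
    by (rule Cons.IH) (use Cons.prems in simp)
  finally show ?case .
qed

lemma pmf_sample:
  assumes "topo G vs"
  shows "pmf (sample (\<lambda>v x. q v (restrict x (parents G v))) vs) x =
    (if \<forall>v. v \<notin> set vs \<longrightarrow> x v = undefined
     then \<Prod>v\<in>set vs. pmf (q v (restrict x (parents G v))) (x v) else 0)"
  using assms
proof (induction vs arbitrary: x)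
  case Nil
  have "(\<forall>v. x v = undefined) \<longleftrightarrow> (\<lambda>_. undefined) = x" by (auto simp: fun_eq_iff)
  then show ?case by (simp add: indicator_def)
next
  case (Cons v vs)
  let ?K = "\<lambda>v x. q v (restrict x (parents G v))"
  let ?x = "x(v := undefined)"
  have v: "v \<notin> set vs" "parents G v \<subseteq> set vs" "topo G vs" using Cons.prems by auto
  \<comment> \<open>\<open>?x\<close> is the only earlier state from which drawing \<open>v\<close>
    can lead to \<open>x\<close>, so the integral over the earlier draws collapses to one
    point.\<close>
  have a: "pmf (map_pmf (\<lambda>a. y(v := a)) (?K v y)) x = indicator {?x} y * pmf (?K v x) (x v)"
    if y: "y \<in> set_pmf (sample ?K vs)" for y
  proof (cases "y = ?x")
    case True
    have e: "restrict y (parents G v) = restrict x (parents G v)"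
      using True v by (auto simp: restrict_eq_iff)
    have "pmf (map_pmf (\<lambda>a. y(v := a)) (?K v y)) ((\<lambda>a. y(v := a)) (x v)) = pmf (?K v y) (x v)"
      by (rule pmf_map_inj') (auto simp: inj_def fun_eq_iff)
    moreover have "(\<lambda>a. y(v := a)) (x v) = x" using True by auto
    ultimately show ?thesis using True e by simp
  next
    case False
    have "x \<notin> set_pmf (map_pmf (\<lambda>a. y(v := a)) (?K v y))"
    proof
      assume "x \<in> set_pmf (map_pmf (\<lambda>a. y(v := a)) (?K v y))"
      then obtain b where "x = y(v := b)" by auto
      moreover have "y v = undefined" using sample_undefined[OF y v(1)] .
      ultimately have "y = ?x" by (auto simp: fun_eq_iff)
      then show False using False by simp
    qed
    then have "pmf (map_pmf (\<lambda>a. y(v := a)) (?K v y)) x = 0" unfolding set_pmf_iff by blast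
    then show ?thesis using False by simp
  qed
  have "pmf (sample ?K (v # vs)) x = (\<integral>y. indicator {?x} y * pmf (?K v x) (x v) \<partial>sample ?K vs)"
    unfolding sample.simps pmf_bind
    by (rule integral_cong_AE) (use a in \<open>auto simp: AE_measure_pmf_iff\<close>)
  also have "\<dots> = pmf (sample ?K vs) ?x * pmf (?K v x) (x v)"
    by (simp add: measure_pmf_single)
  also have "\<dots> = (if \<forall>w. w \<notin> set vs \<longrightarrow> ?x w = undefined
     then \<Prod>w\<in>set vs. pmf (?K w ?x) (?x w) else 0) * pmf (?K v x) (x v)"
    by (simp only: Cons.IH[OF v(3)])
  finally have f1: "pmf (sample ?K (v # vs)) x = \<dots>" .
  have f2: "(\<Prod>w\<in>set vs. pmf (?K w ?x) (?x w)) = (\<Prod>w\<in>set vs. pmf (?K w x) (x w))"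
  proof (rule prod.cong[OF refl])
    fix w assume w: "w \<in> set vs"
    then have "restrict ?x (parents G w) = restrict x (parents G w)"
      using topo_parents[OF v(3) w] v(1) by (auto simp: restrict_eq_iff)
    then show "pmf (?K w ?x) (?x w) = pmf (?K w x) (x w)" using v(1) w by auto
  qed
  have f3: "(\<forall>w. w \<notin> set vs \<longrightarrow> ?x w = undefined) \<longleftrightarrow> (\<forall>w. w \<notin> set (v # vs) \<longrightarrow> x w = undefined)"
    by auto
  show ?case
  proof (cases "\<forall>w. w \<notin> set (v # vs) \<longrightarrow> x w = undefined")
    case True
    then show ?thesis unfolding f1 f2 f3 using v(1)
      by (simp add: mult.commute del: restrict_apply)
  next
    case False
    then show ?thesis unfolding f1 f2 f3 by (simp only: if_False mult_zero_left)
  qed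
qed

lemma ancestral_UNIV: "ancestral G UNIV"
  by (simp add: ancestral_def)

text \<open>Kernels can be prescribed freely, since ancestral sampling realizes them. This supplies
  the proposal distribution for the rejection sampling below.\<close>

lemma dag_kernels_exist:
  fixes G :: "('v::finite \<times> 'v) set" and q :: "'v \<Rightarrow> ('v \<Rightarrow> 's) \<Rightarrow> 's pmf"
  assumes "acyclic G" "\<And>v y. finite (set_pmf (q v y))"
  obtains p where "finite (set_pmf p)"
    "\<And>x. pmf p x = (\<Prod>v\<in>UNIV. pmf (q v (restrict x (parents G v))) (x v))"
proof -
  obtain vs where vs: "topo G vs" "set vs = UNIV"
    using topo_extend[OF assms(1), of "[]" UNIV] ancestral_UNIV by auto
  show ?thesis
  proof (rule that)
    show "finite (set_pmf (sample (\<lambda>v x. q v (restrict x (parents G v))) vs))"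
      by (rule finite_sample) (rule assms)
    show "pmf (sample (\<lambda>v x. q v (restrict x (parents G v))) vs) x =
        (\<Prod>v\<in>UNIV. pmf (q v (restrict x (parents G v))) (x v))" for x
      using pmf_sample[OF vs(1)] vs(2) by simp
  qed
qed

text \<open>List \<open>A\<close> first, then \<open>v\<close>, then the rest. Sampling in this
  order draws \<open>v\<close> from a kernel that reads only the parents, and the later draws are
  marginalized out.\<close>

lemma dag_includes_ci:
  fixes G :: "('v::finite \<times> 'v) set"
  assumes G: "acyclic G" "dag_includes G p"
    and A: "ancestral G A" "parents G v \<subseteq> A" "v \<notin> A"
  shows "ci p (\<lambda>x. x v) (\<lambda>x. restrict x A) (\<lambda>x. restrict x (parents G v))"
proof -
  obtain q where q: "\<And>x. pmf p x = (\<Prod>i\<in>UNIV. pmf (q i (restrict x (parents G i))) (x i))"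
    using G(2) by (auto simp: dag_includes_def)
  obtain ws where ws: "topo G ws" "set ws = A"
    using topo_extend[OF G(1), of "[]" A] A(1) by auto
  then have "topo G (v # ws)" using A by simp
  then obtain us where us: "topo G (us @ v # ws)" "set (us @ v # ws) = UNIV"
    using topo_extend[OF G(1), of "v # ws" UNIV] ancestral_UNIV by auto
  define K where "K = (\<lambda>v x. q v (restrict x (parents G v)))"
  have p: "p = sample K (us @ v # ws)"
    unfolding K_def using q us(2) by (intro pmf_eqI) (subst pmf_sample[OF us(1)], simp)
  define S where "S = parents G v"
  have S: "S \<subseteq> A" "v \<notin> S" using A by (auto simp: S_def)
  \<comment> \<open>The state before the draw and the drawn value are kept apart as a pair, the form
    required by \<open>ci_kernel\<close>.\<close>
  define P where "P = bind_pmf (sample K ws) (\<lambda>x. map_pmf (Pair x) (q v (restrict x S)))"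
  have s: "sample K (v # ws) = map_pmf (\<lambda>(x, a). x(v := a)) P"
    by (simp add: P_def K_def S_def map_bind_pmf pmf.map_comp o_def)
  have "ci P snd fst ((\<lambda>x. restrict x S) \<circ> fst)"
    unfolding P_def by (rule ci_kernel)
  then have "ci P (\<lambda>z. (case z of (x, a) \<Rightarrow> x(v := a)) v) (\<lambda>z. restrict (case z of (x, a) \<Rightarrow> x(v := a)) A)
      (\<lambda>z. restrict (case z of (x, a) \<Rightarrow> x(v := a)) S)"
    by (rule ci_map) (use A S in \<open>auto intro!: determinesI simp: restrict_eq_iff subset_iff\<close>)
  then have "ci (sample K (v # ws)) (\<lambda>x. x v) (\<lambda>x. restrict x A) (\<lambda>x. restrict x S)"
    unfolding s ci_map_pmf by (simp add: o_def)
  then have "ci (map_pmf (\<lambda>x. restrict x (set (v # ws))) p) (\<lambda>x. x v) (\<lambda>x. restrict x A) (\<lambda>x. restrict x S)"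
    unfolding p map_restrict_sample[OF us(1)] .
  then show ?thesis
    unfolding ci_map_pmf S_def[symmetric]
    by (rule ci_map) (use A S ws in \<open>auto intro!: determinesI simp: restrict_eq_iff subset_iff\<close>)
qed

section \<open>Topological orders given by injective numberings\<close>

definition ranking :: "('v \<times> 'v) set \<Rightarrow> ('v \<Rightarrow> nat) \<Rightarrow> bool" where
  "ranking G r \<longleftrightarrow> inj r \<and> (\<forall>(u, v)\<in>G. r u < r v)"

lemma rankingD: "ranking G r \<Longrightarrow> (u, v) \<in> G \<Longrightarrow> r u < r v"
  by (auto simp: ranking_def)

lemma ranking_acyclic: "ranking G r \<Longrightarrow> acyclic G"
  by (rule acyclic_subset[OF wf_acyclic[OF wf_measure[of r]]]) (auto simp: ranking_def)

lemma acyclic_ranking: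
  fixes G :: "('v::finite \<times> 'v) set"
  assumes "acyclic G"
  obtains r where "ranking G r"
proof -
  obtain idx :: "'v \<Rightarrow> nat" and n where idx: "idx ` UNIV = {i. i < n}" "inj idx"
    using finite_imp_inj_to_nat_seg[OF finite_class.finite_UNIV] by metis
  have idx_less: "idx v < n" for v using idx(1) by blast
  define h where "h v = card {u. (u, v) \<in> G\<^sup>+}" for v
  have h: "h u < h v" if "(u, v) \<in> G" for u v
    unfolding h_def
  proof (rule psubset_card_mono)
    have "u \<notin> {w. (w, u) \<in> G\<^sup>+}" using assms by (simp add: acyclic_def)
    then show "{w. (w, u) \<in> G\<^sup>+} \<subset> {w. (w, v) \<in> G\<^sup>+}" using that
      by (auto intro: trancl_into_trancl)
  qed simp
  \<comment> \<open>Leading digit: the number of ancestors, which grows along edges. Last digit in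
    base \<open>n\<close>: an index below \<open>n\<close>, which separates ties.\<close>
  define r where "r v = h v * n + idx v" for v
  have div: "r v div n = h v" "r v mod n = idx v" for v
    using idx_less[of v] by (auto simp: r_def)
  have "inj r"
    by (rule injI) (metis div(2) idx(2) injD)
  moreover have "r u < r v" if "(u, v) \<in> G" for u v
  proof (rule ccontr)
    assume "\<not> r u < r v"
    then have "r v div n \<le> r u div n" by (intro div_le_mono) simp
    then show False using h[OF that] div by simp
  qed
  ultimately have "ranking G r" by (auto simp: ranking_def)
  then show ?thesis by (rule that)
qed

lemma ranking_ancestral: "ranking G r \<Longrightarrow> ancestral G {u. r u < k}"
  by (auto simp: ranking_def ancestral_def intro: less_trans)

lemma ranking_ci:
  fixes G :: "('v::finite \<times> 'v) set"
  assumes "ranking G r" "dag_includes G p"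
  shows "ci p (\<lambda>x. x v) (\<lambda>x. restrict x {u. r u < r v}) (\<lambda>x. restrict x (parents G v))"
  by (rule dag_includes_ci[OF ranking_acyclic[OF assms(1)] assms(2) ranking_ancestral[OF assms(1)]])
    (use assms(1) in \<open>auto simp: parents_def dest: rankingD\<close>)

section \<open>From the ordered Markov property back to a factorization\<close>

lemma measure_cond_pmf:
  assumes "set_pmf p \<inter> B \<noteq> {}"
  shows "measure_pmf.prob (cond_pmf p B) A = measure_pmf.prob p (A \<inter> B) / measure_pmf.prob p B"
proof -
  have "emeasure (measure_pmf p) B \<noteq> 0"
    using assms by (metis measure_pmf_zero_iff measure_pmf.emeasure_eq_measure ennreal_eq_0_iff measure_le_0_iff)
  then show ?thesis
    unfolding cond_pmf.rep_eq[OF assms]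
    by (subst measure_uniform_measure) (simp_all add: Int_commute)
qed

text \<open>The kernels are the conditional distributions of \<open>p\<close>; along the ranking,
  the independence at each new variable contributes one factor to the marginal. Finite kernels are
  recorded because simulations built from them must have finite support again.\<close>

lemma ci_factorization:
  fixes G :: "('v::finite \<times> 'v) set" and p :: "('v \<Rightarrow> 's) pmf"
  assumes r: "ranking G r"
    and ci: "\<And>v. ci p (\<lambda>x. x v) (\<lambda>x. restrict x {u. r u < r v}) (\<lambda>x. restrict x (parents G v))"
    and fin: "finite (set_pmf p)"
  obtains q where "\<And>x. pmf p x = (\<Prod>i\<in>UNIV. pmf (q i (restrict x (parents G i))) (x i))"
    "\<And>i y. finite (set_pmf (q i y))"
proof -
  let ?P = "measure_pmf.prob p"
  define E where "E A y = {x :: 'v \<Rightarrow> 's. restrict x A = y}" for A y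
  \<comment> \<open>Parent configurations of probability zero get an arbitrary kernel; in the
    multiplied-out form of the next fact both sides are then 0.\<close>
  define q where "q i y = (if set_pmf p \<inter> E (parents G i) y = {} then return_pmf undefined
     else map_pmf (\<lambda>x. x i) (cond_pmf p (E (parents G i) y)))" for i y
  have finq: "finite (set_pmf (q i y))" for i y
    using fin by (auto simp: q_def)
  have q: "pmf (q i y) a * ?P (E (parents G i) y) = ?P {x. x i = a \<and> restrict x (parents G i) = y}" for i y a
  proof (cases "set_pmf p \<inter> E (parents G i) y = {}")
    case True
    then have "?P (E (parents G i) y) = 0"
      by (simp add: measure_pmf_zero_iff)
    moreover have "?P {x. x i = a \<and> restrict x (parents G i) = y} = 0"
      using True by (subst measure_pmf_zero_iff) (auto simp: E_def)
    ultimately show ?thesis by simp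
  next
    case False
    then have "pmf (q i y) a = measure_pmf.prob (cond_pmf p (E (parents G i) y)) {x. x i = a}"
      by (simp add: q_def pmf_map vimage_def)
    also have "\<dots> = measure_pmf.prob p ({x. x i = a} \<inter> E (parents G i) y) / ?P (E (parents G i) y)"
      by (rule measure_cond_pmf[OF False])
    finally have "pmf (q i y) a = measure_pmf.prob p ({x. x i = a} \<inter> E (parents G i) y) / ?P (E (parents G i) y)" .
    moreover have "?P (E (parents G i) y) \<noteq> 0"
      using False by (simp only: measure_pmf_zero_iff not_False_eq_True)
    moreover have "{x. x i = a} \<inter> E (parents G i) y = {x. x i = a \<and> restrict x (parents G i) = y}"
      by (auto simp: E_def)
    ultimately show ?thesis by simp
  qed
  have main: "?P {x. restrict x {u. r u < n} = restrict y {u. r u < n}} =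
      (\<Prod>i\<in>{u. r u < n}. pmf (q i (restrict y (parents G i))) (y i))" for n y
  proof (induction n)
    case 0
    show ?case by simp
  next
    case (Suc n)
    show ?case
    proof (cases "\<exists>v. r v = n")
      case False
      then have "{u. r u < Suc n} = {u. r u < n}" by (auto simp: less_Suc_eq)
      then show ?thesis using Suc by simp
    next
      case True
      then obtain v where v: "r v = n" by blast
      have inj: "r u = n \<longleftrightarrow> u = v" for u using r v by (auto simp: ranking_def inj_def)
      let ?A = "{u. r u < n}" and ?S = "parents G v"
      have A: "{u. r u < Suc n} = insert v ?A" "v \<notin> ?A" using inj by (auto simp: less_Suc_eq v)
      have S: "?S \<subseteq> ?A" using r v by (auto simp: parents_def dest: rankingD)
      have fA: "finite ?A" by simp
      have e1: "{x. restrict x {u. r u < Suc n} = restrict y {u. r u < Suc n}} =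
          {x. x v \<in> {y v} \<and> restrict x ?A \<in> {restrict y ?A} \<and> restrict x ?S = restrict y ?S}"
        unfolding A(1) using S by (auto simp: restrict_eq_iff)
      have e2: "{x. restrict x ?A \<in> {restrict y ?A} \<and> restrict x ?S = restrict y ?S} =
          {x. restrict x ?A = restrict y ?A}"
        using S by (auto simp: restrict_eq_iff)
      have i: "?P {x. restrict x {u. r u < Suc n} = restrict y {u. r u < Suc n}} *
          ?P {x. restrict x ?S = restrict y ?S} =
          ?P {x. x v \<in> {y v} \<and> restrict x ?S = restrict y ?S} * ?P {x. restrict x ?A = restrict y ?A}"
        unfolding e1 using ciD[OF ci[of v], of "{y v}" "{restrict y ?A}" "restrict y ?S"]
        unfolding v e2 .
      have "?P {x. restrict x {u. r u < Suc n} = restrict y {u. r u < Suc n}} =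
          pmf (q v (restrict y ?S)) (y v) * ?P {x. restrict x ?A = restrict y ?A}"
      proof (cases "?P {x. restrict x ?S = restrict y ?S} = 0")
        case True
        have "?P {x. restrict x {u. r u < Suc n} = restrict y {u. r u < Suc n}} = 0"
          unfolding e1 by (rule prob_eq_0_mono[OF True]) simp
        moreover have "?P {x. restrict x ?A = restrict y ?A} = 0"
          by (rule prob_eq_0_mono[OF True]) (use S in \<open>auto simp: restrict_eq_iff\<close>)
        ultimately show ?thesis by simp
      next
        case False
        have "?P {x. x v \<in> {y v} \<and> restrict x ?S = restrict y ?S} =
            pmf (q v (restrict y ?S)) (y v) * ?P {x. restrict x ?S = restrict y ?S}"
          using q[of v "restrict y ?S" "y v"] by (simp add: E_def)
        note i[unfolded this]
        moreover have "a * s = k * s * c \<Longrightarrow> s \<noteq> 0 \<Longrightarrow> a = k * c" for a s k c :: real by simp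
        ultimately show ?thesis using False by blast
      qed
      then show ?thesis
        unfolding Suc A(1) using A(2) fA by (simp del: restrict_apply)
    qed
  qed
  obtain N where N: "\<And>v. r v < N"
    using finite_nat_set_iff_bounded[of "range r"] by auto
  have "pmf p y = (\<Prod>i\<in>UNIV. pmf (q i (restrict y (parents G i))) (y i))" for y
  proof -
    have "{x. restrict x UNIV = restrict y UNIV} = {y}" by (auto simp: restrict_eq_iff)
    then show ?thesis using main[of N y] N by (simp add: measure_pmf_single)
  qed
  then show ?thesis using finq by (rule that)
qed

lemma dag_includesI:
  fixes G :: "('v::finite \<times> 'v) set"
  assumes "ranking G r" "finite (set_pmf p)"
    and "\<And>v. ci p (\<lambda>x. x v) (\<lambda>x. restrict x {u. r u < r v}) (\<lambda>x. restrict x (parents G v))"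
  shows "dag_includes G p"
  using ci_factorization[OF assms(1,3,2)] unfolding dag_includes_def by metis

text \<open>The kernels in \<open>dag_includes\<close> may have infinite support at parent
  configurations of probability zero; the detour through independence replaces them by finite
  ones.\<close>

lemma dag_includes_finite_kernels:
  fixes G :: "('v::finite \<times> 'v) set"
  assumes "acyclic G" "dag_includes G p" "finite (set_pmf p)"
  obtains q where "\<And>x. pmf p x = (\<Prod>i\<in>UNIV. pmf (q i (restrict x (parents G i))) (x i))"
    "\<And>i y. finite (set_pmf (q i y))"
proof -
  obtain r where r: "ranking G r" using acyclic_ranking[OF assms(1)] .
  show ?thesis by (rule ci_factorization[OF r ranking_ci[OF r assms(2)] assms(3)]) (rule that)
qed

section \<open>Inclusion of DAG models and covered edges\<close>

text \<open>\<open>dag_le\<close> speaks of states in \<open>nat\<close> only. The finitely many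
  states occurring under \<open>p\<close> are recoded injectively, which preserves all independences
  in both directions.\<close>

lemma dag_le_transfer:
  fixes G H :: "('v::finite \<times> 'v) set" and p :: "('v \<Rightarrow> 's) pmf"
  assumes "acyclic G" "acyclic H" "dag_le G H" and fin: "finite (set_pmf p)" and "dag_includes G p"
  shows "dag_includes H p"
proof -
  define T where "T = (\<Union>x\<in>set_pmf p. range x)"
  have "finite T" using fin by (auto simp: T_def)
  then obtain f :: "'s \<Rightarrow> nat" where f: "inj_on f T"
    using finite_imp_inj_to_nat_seg by metis
  define \<phi> where "\<phi> x = f \<circ> x" for x :: "'v \<Rightarrow> 's"
  have v: "\<phi> x v = \<phi> y v \<longleftrightarrow> x v = y v" if "x \<in> set_pmf p" "y \<in> set_pmf p" for x y v
    using that inj_onD[OF f, of "x v" "y v"] by (auto simp: T_def \<phi>_def)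
  have A: "restrict (\<phi> x) A = restrict (\<phi> y) A \<longleftrightarrow> restrict x A = restrict y A"
    if "x \<in> set_pmf p" "y \<in> set_pmf p" for x y A
    using v[OF that] by (simp add: restrict_eq_iff)
  have ci: "ci (map_pmf \<phi> p) (\<lambda>x. x v) (\<lambda>x. restrict x A) (\<lambda>x. restrict x S) \<longleftrightarrow>
      ci p (\<lambda>x. x v) (\<lambda>x. restrict x A) (\<lambda>x. restrict x S)" for v A S
  proof -
    have 1: "ci p (\<lambda>x. \<phi> x v) (\<lambda>x. restrict (\<phi> x) A) (\<lambda>x. restrict (\<phi> x) S)"
      if "ci p (\<lambda>x. x v) (\<lambda>x. restrict x A) (\<lambda>x. restrict x S)"
      by (rule ci_map[OF that]) (auto intro!: determinesI simp: v A)
    have 2: "ci p (\<lambda>x. x v) (\<lambda>x. restrict x A) (\<lambda>x. restrict x S)"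
      if "ci p (\<lambda>x. \<phi> x v) (\<lambda>x. restrict (\<phi> x) A) (\<lambda>x. restrict (\<phi> x) S)"
      by (rule ci_map[OF that]) (auto intro!: determinesI simp: v A)
    show ?thesis unfolding ci_map_pmf o_def using 1 2 by blast
  qed
  obtain r where r: "ranking G r" using acyclic_ranking[OF assms(1)] .
  have "dag_includes G (map_pmf \<phi> p)"
    by (rule dag_includesI[OF r]) (use fin ci ranking_ci[OF r assms(5)] in simp_all)
  then have H: "dag_includes H (map_pmf \<phi> p)"
    using assms(3) fin unfolding dag_le_def by simp
  obtain s where s: "ranking H s" using acyclic_ranking[OF assms(2)] .
  show ?thesis
    by (rule dag_includesI[OF s fin]) (use ci ranking_ci[OF s H] in simp)
qed

text \<open>Kernels of the larger graph may ignore the additional parents.\<close>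

lemma dag_includes_subset:
  assumes "G \<subseteq> H" "dag_includes G p"
  shows "dag_includes H p"
proof -
  obtain q where q: "\<And>x. pmf p x = (\<Prod>i\<in>UNIV. pmf (q i (restrict x (parents G i))) (x i))"
    using assms(2) by (auto simp: dag_includes_def)
  have "restrict (restrict x (parents H i)) (parents G i) = restrict x (parents G i)" for x :: "_ \<Rightarrow> 'b" and i
    using assms(1) by (auto simp: restrict_def fun_eq_iff parents_def)
  then have "\<forall>x. pmf p x = (\<Prod>i\<in>UNIV. pmf ((\<lambda>i y. q i (restrict y (parents G i))) i (restrict x (parents H i))) (x i))"
    using q by simp
  then show ?thesis unfolding dag_includes_def
    by (intro exI[of _ "\<lambda>i y. q i (restrict y (parents G i))"])
qed

lemma dag_le_subset: "G \<subseteq> H \<Longrightarrow> dag_le G H"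
  by (auto simp: dag_le_def intro: dag_includes_subset)

lemma dag_le_refl: "dag_le G G"
  by (simp add: dag_le_def)

lemma dag_le_trans: "dag_le G H \<Longrightarrow> dag_le H K \<Longrightarrow> dag_le G K"
  by (simp add: dag_le_def)

text \<open>A fair coin shared by two variables makes them inseparable, so a DAG including that
  distribution must join them; the order of \<open>H\<close> decides the direction.\<close>

lemma dag_le_edge:
  fixes G H :: "('v::finite \<times> 'v) set"
  assumes ac: "acyclic G" and edge: "(a, b) \<in> G" and le: "dag_le G H"
    and s: "ranking H s" and ab: "s a < s b"
  shows "(a, b) \<in> H"
proof (rule ccontr)
  assume "(a, b) \<notin> H"
  \<comment> \<open>\<open>a\<close> and \<open>b\<close> copy one fair coin, all other variables are constant\<close>
  define \<phi> where "\<phi> = (\<lambda>(c::nat) v. if v = a \<or> v = b then c else 0)"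
  define p where "p = map_pmf \<phi> (pmf_of_set {0, 1})"
  obtain r where r: "ranking G r" using acyclic_ranking[OF ac] .
  have rab: "r a < r b" using rankingD[OF r edge] .
  have fin: "finite (set_pmf p)" by (simp add: p_def)
  have "dag_includes G p"
  proof (rule dag_includesI[OF r fin])
    fix v
    consider "v = a" | "v = b" | "v \<noteq> a" "v \<noteq> b" by blast
    then show "ci p (\<lambda>x. x v) (\<lambda>x. restrict x {u. r u < r v}) (\<lambda>x. restrict x (parents G v))"
    proof cases
      case 1
      then show ?thesis unfolding p_def ci_map_pmf
        by (intro ci_sym[OF ci_trivial] determinesI) (use rab in \<open>auto simp: restrict_eq_iff \<phi>_def\<close>)
    next
      case 2
      then show ?thesis unfolding p_def ci_map_pmf
        by (intro ci_trivial determinesI) (use edge in \<open>auto simp: restrict_eq_iff \<phi>_def parents_def split: if_splits\<close>)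
    next
      case 3
      then show ?thesis unfolding p_def ci_map_pmf
        by (intro ci_trivial determinesI) (auto simp: restrict_eq_iff \<phi>_def)
    qed
  qed
  then have "dag_includes H p" using le fin by (simp add: dag_le_def)
  then have "ci p (\<lambda>x. x b) (\<lambda>x. restrict x {u. s u < s b}) (\<lambda>x. restrict x (parents H b))"
    by (rule ranking_ci[OF s])
  then have "ci (pmf_of_set {0, 1}) (\<lambda>c. \<phi> c b) (\<lambda>c. restrict (\<phi> c) {u. s u < s b}) (\<lambda>c. restrict (\<phi> c) (parents H b))"
    unfolding p_def ci_map_pmf by (simp add: o_def)
  \<comment> \<open>Neither \<open>a\<close> nor \<open>b\<close> is a parent of \<open>b\<close> in
    \<open>H\<close>, so the conditioning variables are constant.\<close>
  then have "ci (pmf_of_set {0, 1}) (\<lambda>c. \<phi> c b) (\<lambda>c. restrict (\<phi> c) {u. s u < s b}) (\<lambda>_. ())"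
  proof (rule ci_map)
    have "b \<notin> parents H b" using rankingD[OF s, of b b] by (auto simp: parents_def)
    moreover have "a \<notin> parents H b" using \<open>(a, b) \<notin> H\<close> by (simp add: parents_def)
    ultimately show "determines (pmf_of_set {0, 1}) (\<lambda>_. ()) (\<lambda>c. restrict (\<phi> c) (parents H b))"
      by (auto intro!: determinesI simp: restrict_eq_iff \<phi>_def)
  qed (auto intro!: determinesI)
  \<comment> \<open>\<open>a\<close> precedes \<open>b\<close> in \<open>s\<close>, so the
    predecessors reveal the coin, which would be independent of itself.\<close>
  then have "ci (pmf_of_set {0, 1::nat}) (\<lambda>c. c) (\<lambda>c. c) (\<lambda>_. ())"
  proof (rule ci_map)
    have *: "x = y" if "restrict (\<phi> x) {u. s u < s b} = restrict (\<phi> y) {u. s u < s b}" for x y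
      using that ab unfolding restrict_eq_iff by (auto simp: \<phi>_def dest!: bspec[where x = a])
    show "determines (pmf_of_set {0, 1}) (\<lambda>x. (restrict (\<phi> x) {u. s u < s b}, ())) (\<lambda>c. c)"
      by (rule determinesI) (use * in blast)
  qed (auto intro!: determinesI simp: \<phi>_def)
  from ciD[OF this, of "{0}" "{0}" "()"] show False
    by (simp add: measure_pmf_of_set)
qed

lemma not_dag_le_insert_edge:
  fixes G :: "('v::finite \<times> 'v) set"
  assumes ac: "acyclic (insert (a, b) G)" and "(a, b) \<notin> G"
  shows "\<not> dag_le (insert (a, b) G) G"
proof
  assume le: "dag_le (insert (a, b) G) G"
  obtain r where r: "ranking (insert (a, b) G) r" using acyclic_ranking[OF ac] .
  then have "ranking G r" "r a < r b" by (auto simp: ranking_def)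
  then have "(a, b) \<in> G" using dag_le_edge[OF ac _ le] by blast
  then show False using assms(2) by simp
qed

text \<open>Given the parents of \<open>Y\<close>, the pair \<open>(Y, Z)\<close> is jointly
  independent of the nondescendants of \<open>Y\<close>. This is symmetric in the pair, so the two
  can be drawn in the opposite order.\<close>

lemma covered_reversal_le:
  fixes G :: "('v::finite \<times> 'v) set"
  assumes ac: "acyclic G" and YZ: "(Y, Z) \<in> G" and cov: "parents G Z = insert Y (parents G Y)"
  defines "G2 \<equiv> insert (Z, Y) (G - {(Y, Z)})"
  shows "acyclic G2" "dag_le G G2"
proof -
  obtain r where r: "ranking G r" using acyclic_ranking[OF ac] .
  have irr: "r u < r v" if "(u, v) \<in> G" for u v using rankingD[OF r that] .
  have neq: "Y \<noteq> Z" using irr[OF YZ] by auto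
  define De where "De = {w. (Y, w) \<in> G\<^sup>*}"
  have De: "w \<in> De" if "(u, w) \<in> G" "u \<in> De" for u w
    using that by (auto simp: De_def intro: rtrancl_into_rtrancl)
  have YDe: "Y \<in> De" "Z \<in> De" using YZ by (auto simp: De_def)
  have le: "r u \<le> r v" if "(u, v) \<in> G\<^sup>*" for u v
    using that by (induction rule: rtrancl_induct) (auto dest: irr)
  have PDe: "u \<notin> De" if "u \<in> parents G Y" for u
    using le[of Y u] irr[of u Y] that by (auto simp: De_def parents_def)
  have PZ: "(u, Z) \<in> G \<longleftrightarrow> u = Y \<or> u \<in> parents G Y" for u
    using cov by (auto simp: parents_def)
  have PY: "(u, Y) \<in> G \<longleftrightarrow> u \<in> parents G Y" for u by (simp add: parents_def)
  obtain M where M: "\<And>v. r v < M"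
    using finite_nat_set_iff_bounded[of "range r"] by auto
  \<comment> \<open>an order of \<open>G\<close> in which \<open>Y\<close> and \<open>Z\<close> are consecutive, so that swapping them gives one of \<open>G2\<close>\<close>
  define s where "s = (\<lambda>a b v. if v \<notin> De then r v else if v = Y then M + a else if v = Z then M + b else M + 2 + r v)"
  have inj_r: "r u = r v \<longleftrightarrow> u = v" for u v using r by (auto simp: ranking_def inj_def)
  have "inj (s a b)" if "a \<noteq> b" "a < 2" "b < 2" for a b
  proof (rule injI)
    fix u v assume "s a b u = s a b v"
    then show "u = v"
      using M[of u] M[of v] inj_r[of u v] that by (auto simp: s_def split: if_splits)
  qed
  then have "inj (s 0 1)" "inj (s 1 0)" by simp_all
  moreover have "s 0 1 u < s 0 1 v" if "(u, v) \<in> G" for u v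
    using that irr[OF that] De[OF that] M[of u] neq PDe[of u] PY[of u] PZ[of u] YDe
    by (auto simp: s_def intro: trans_less_add1)
  moreover have "s 1 0 u < s 1 0 v" if "(u, v) \<in> G2" for u v
    using that irr[of u v] De[of u v] M[of u] neq PDe[of u] PY[of u] PZ[of u] YDe
    by (auto simp: s_def G2_def intro: trans_less_add1)
  ultimately have s: "ranking G (s 0 1)" "ranking G2 (s 1 0)"
    by (auto simp: ranking_def)
  show "acyclic G2" by (rule ranking_acyclic[OF s(2)])
  \<comment> \<open>In either order, the first of the pair is preceded exactly by the nondescendants
    of \<open>Y\<close>, and the second by these and the first.\<close>
  have sets: "{u. s 0 1 u < s 0 1 Y} = - De" "{u. s 0 1 u < s 0 1 Z} = insert Y (- De)"
    "{u. s 1 0 u < s 1 0 Z} = - De" "{u. s 1 0 u < s 1 0 Y} = insert Z (- De)"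
    using M YDe neq by (auto simp: s_def intro: trans_less_add1 less_SucI)
  have others: "{u. s 1 0 u < s 1 0 v} = {u. s 0 1 u < s 0 1 v}" if "v \<noteq> Y" "v \<noteq> Z" for v
    using that M[of v] by (auto simp: s_def)
  show "dag_le G G2"
    unfolding dag_le_def
  proof (intro allI impI)
    fix p :: "('v \<Rightarrow> nat) pmf"
    assume fin: "finite (set_pmf p)" and inc: "dag_includes G p"
    let ?A = "\<lambda>x::'v \<Rightarrow> nat. restrict x (- De)" and ?P = "\<lambda>x::'v \<Rightarrow> nat. restrict x (parents G Y)"
    have sub: "parents G Y \<subseteq> - De" using PDe by auto
    have cY: "ci p ?A (\<lambda>x. x Y) ?P"
      using ranking_ci[OF s(1) inc, of Y] unfolding sets by (rule ci_sym)
    have "ci p (\<lambda>x. restrict x (insert Y (- De))) (\<lambda>x. x Z) (\<lambda>x. restrict x (insert Y (parents G Y)))"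
      using ranking_ci[OF s(1) inc, of Z] unfolding sets cov by (rule ci_sym)
    then have "ci p ?A (\<lambda>x. x Z) (\<lambda>x. (x Y, ?P x))"
      by (rule ci_map) (use sub in \<open>auto intro!: determinesI simp: restrict_eq_iff\<close>)
    from ci_contraction[OF fin cY this]
    have c: "ci p ?A (\<lambda>x. (x Y, x Z)) ?P" .
    show "dag_includes G2 p"
    proof (rule dag_includesI[OF s(2) fin])
      fix v
      consider "v = Y" | "v = Z" | "v \<noteq> Y" "v \<noteq> Z" by blast
      then show "ci p (\<lambda>x. x v) (\<lambda>x. restrict x {u. s 1 0 u < s 1 0 v}) (\<lambda>x. restrict x (parents G2 v))"
      proof cases
        case 1
        have P2: "parents G2 Y = insert Z (parents G Y)" using neq by (auto simp: G2_def parents_def)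
        have "ci p ?A (\<lambda>x. x Y) (\<lambda>x. restrict x (insert Z (parents G Y)))"
          by (rule ci_map[OF c]) (auto intro!: determinesI simp: restrict_eq_iff)
        then show ?thesis unfolding 1 sets P2
          by (rule ci_sym[OF ci_left]) (auto intro!: determinesI simp: restrict_eq_iff)
      next
        case 2
        have P2: "parents G2 Z = parents G Y"
          using neq PZ irr[of Y Y] by (auto simp: G2_def parents_def)
        have "ci p ?A (\<lambda>x. x Z) ?P"
          by (rule ci_map[OF c]) (auto intro!: determinesI simp: restrict_eq_iff)
        then show ?thesis unfolding 2 sets P2 by (rule ci_sym)
      next
        case 3
        have P2: "parents G2 v = parents G v" using 3 by (auto simp: G2_def parents_def)
        show ?thesis unfolding others[OF 3] P2 by (rule ranking_ci[OF s(1) inc])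
      qed
    qed
  qed
qed

text \<open>The reversed edge is covered again and its reversal restores \<open>G\<close>, so the
  inclusion already proved applies both ways.\<close>

lemma covered_reversal:
  fixes G :: "('v::finite \<times> 'v) set"
  assumes ac: "acyclic G" and YZ: "(Y, Z) \<in> G" and cov: "parents G Z = insert Y (parents G Y)"
  defines "G2 \<equiv> insert (Z, Y) (G - {(Y, Z)})"
  shows "acyclic G2" "dag_equiv G G2"
proof -
  note 1 = covered_reversal_le[OF ac YZ cov, folded G2_def]
  show "acyclic G2" by (rule 1)
  obtain r where r: "ranking G r" using acyclic_ranking[OF ac] .
  have n: "(Z, Y) \<notin> G" "(Y, Y) \<notin> G" "Y \<noteq> Z"
    using rankingD[OF r, of Z Y] rankingD[OF r YZ] rankingD[OF r, of Y Y] by auto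
  have "insert (Y, Z) (G2 - {(Z, Y)}) = G" using YZ n by (auto simp: G2_def)
  moreover have "parents G2 Y = insert Z (parents G2 Z)"
    using n cov by (auto simp: G2_def parents_def set_eq_iff)
  ultimately show "dag_equiv G G2"
    using covered_reversal_le(2)[OF 1(1), of Z Y] 1(2) by (simp add: dag_equiv_def G2_def)
qed

lemma ranking_rtrancl:
  assumes "ranking G r" "(u, v) \<in> G\<^sup>*"
  shows "r u \<le> r v"
  using assms(2) by (induction rule: rtrancl_induct) (auto dest: rankingD[OF assms(1)])

section \<open>Adding an edge below a larger model\<close>

text \<open>First of three simulations that carry an independence of \<open>H\<close> back to a
  distribution with an added edge. The bound \<open>s V \<le> s Y\<close> keeps the copy out of the
  predecessors and parents of \<open>V\<close>; at \<open>V = Y\<close> it sits on the tested side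
  and is dropped.\<close>

lemma add_edge_to_child:
  fixes G H :: "('v::finite \<times> 'v) set" and p :: "('v \<Rightarrow> 's) pmf"
  assumes G: "acyclic G" and XY: "(X, Y) \<in> G" and YZ: "(Y, Z) \<in> G"
    and le: "dag_le G H" and s: "ranking H s" and V: "s V \<le> s Y"
    and fin: "finite (set_pmf p)" and inc: "dag_includes (insert (X, Z) G) p"
  shows "ci p (\<lambda>x. x V) (\<lambda>x. restrict x {u. s u < s V}) (\<lambda>x. restrict x (parents H V))"
proof -
  let ?G' = "insert (X, Z) G"
  \<comment> \<open>if \<open>Y\<close> carries a copy of \<open>X\<close>, then \<open>Z\<close> can read \<open>X\<close> from its parent \<open>Y\<close>\<close>
  define \<phi> where "\<phi> x v = (x v, if v = Y then x X else undefined)" for x :: "'v \<Rightarrow> 's" and v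
  obtain r where r: "ranking G r" using acyclic_ranking[OF G] .
  have XYZ: "r X < r Y" "r Y < r Z" using rankingD[OF r] XY YZ by auto
  then have r': "ranking ?G' r" using r by (auto simp: ranking_def)
  have "dag_includes G (map_pmf \<phi> p)"
  proof (rule dag_includesI[OF r])
    fix v
    have par: "r u < r v" if "(u, v) \<in> G" for u using rankingD[OF r that] .
    show "ci (map_pmf \<phi> p) (\<lambda>x. x v) (\<lambda>x. restrict x {u. r u < r v}) (\<lambda>x. restrict x (parents G v))"
      unfolding ci_map_pmf
    proof (rule ci_map[OF ranking_ci[OF r' inc, of v]])
      have "r X < r v" if "(Y, v) \<in> G" using par[OF that] XYZ by simp
      then show "determines p (\<lambda>x. (restrict x {u. r u < r v}, restrict x (parents ?G' v)))
          ((\<lambda>x. restrict x (parents G v)) \<circ> \<phi>)"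
        using par by (auto intro!: determinesI simp: restrict_eq_iff \<phi>_def parents_def)
      have copy: "x X = y X" if "\<forall>a\<in>parents G Z. \<phi> x a = \<phi> y a" for x y
        using bspec[OF that, of Y] YZ by (simp add: \<phi>_def parents_def)
      have "x a = y a" if "\<forall>a\<in>parents G v. \<phi> x a = \<phi> y a" "a \<in> parents ?G' v" for x y a
      proof (cases "a \<in> parents G v")
        case True
        then show ?thesis using that(1) by (simp add: \<phi>_def)
      next
        case False
        then have "a = X" "v = Z" using that(2) by (auto simp: parents_def)
        then show ?thesis using copy[of x y] that(1) by simp
      qed
      then show "determines p ((\<lambda>x. restrict x (parents G v)) \<circ> \<phi>) (\<lambda>x. restrict x (parents ?G' v))"
        unfolding determines_def restrict_eq_iff o_def by blast
    qed (use XY XYZ in \<open>auto intro!: determinesI simp: restrict_eq_iff \<phi>_def parents_def dest: less_trans\<close>)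
  qed (use fin in simp)
  then have "dag_includes H (map_pmf \<phi> p)"
    by (intro dag_le_transfer[OF G ranking_acyclic[OF s] le]) (use fin in simp_all)
  from ranking_ci[OF s this, of V]
  have "ci p (\<lambda>x. \<phi> x V) (\<lambda>x. restrict (\<phi> x) {u. s u < s V}) (\<lambda>x. restrict (\<phi> x) (parents H V))"
    unfolding ci_map_pmf o_def .
  moreover have "u \<noteq> Y" if "s u < s V" for u using that V by auto
  moreover have "Y \<notin> parents H V" using rankingD[OF s, of Y V] V by (auto simp: parents_def)
  ultimately show ?thesis
    by - (erule ci_map, auto intro!: determinesI simp: restrict_eq_iff \<phi>_def)
qed

text \<open>Making \<open>Y\<close> and all its descendants constant erases every effect of the new
  edge, which leaves a distribution of \<open>G\<close>. These variables come after \<open>V\<close>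
  in \<open>s\<close>, so the independence at \<open>V\<close> reads only untouched
  coordinates.\<close>

lemma add_edge_nondescendants:
  fixes G H :: "('v::finite \<times> 'v) set" and p :: "('v \<Rightarrow> 's) pmf"
  assumes G': "acyclic (insert (X, Y) G)"
    and le: "dag_le G H" and s: "ranking H s" and V: "\<And>u. (Y, u) \<in> G\<^sup>* \<Longrightarrow> s V < s u"
    and fin: "finite (set_pmf p)" and inc: "dag_includes (insert (X, Y) G) p"
  shows "ci p (\<lambda>x. x V) (\<lambda>x. restrict x {u. s u < s V}) (\<lambda>x. restrict x (parents H V))"
proof -
  let ?G' = "insert (X, Y) G"
  define De where "De = {w. (Y, w) \<in> G\<^sup>*}"
  define \<phi> where "\<phi> x v = (if v \<in> De then undefined else x v)" for x :: "'v \<Rightarrow> 's" and v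
  have De: "w \<in> De" if "(u, w) \<in> G" "u \<in> De" for u w
    using that by (auto simp: De_def intro: rtrancl_into_rtrancl)
  have Y: "Y \<in> De" by (simp add: De_def)
  obtain r where r': "ranking ?G' r" using acyclic_ranking[OF G'] .
  then have r: "ranking G r" by (auto simp: ranking_def)
  have "dag_includes G (map_pmf \<phi> p)"
  proof (rule dag_includesI[OF r])
    fix v
    show "ci (map_pmf \<phi> p) (\<lambda>x. x v) (\<lambda>x. restrict x {u. r u < r v}) (\<lambda>x. restrict x (parents G v))"
    proof (cases "v \<in> De")
      case True
      then show ?thesis unfolding ci_map_pmf
        by (intro ci_trivial determinesI) (simp add: \<phi>_def)
    next
      case False
      then have "u \<notin> De" if "(u, v) \<in> G" for u using De[OF that] by blast
      then show ?thesis unfolding ci_map_pmf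
        by (intro ci_map[OF ranking_ci[OF r' inc, of v]])
          (use False Y in \<open>auto intro!: determinesI simp: restrict_eq_iff \<phi>_def parents_def\<close>)
    qed
  qed (use fin in simp)
  then have "dag_includes H (map_pmf \<phi> p)"
    by (intro dag_le_transfer[OF ranking_acyclic[OF r] ranking_acyclic[OF s] le]) (use fin in simp_all)
  from ranking_ci[OF s this, of V]
  have "ci p (\<lambda>x. \<phi> x V) (\<lambda>x. restrict (\<phi> x) {u. s u < s V}) (\<lambda>x. restrict (\<phi> x) (parents H V))"
    unfolding ci_map_pmf o_def .
  moreover have "u \<notin> De" if "s u \<le> s V" for u using that V[of u] by (auto simp: De_def)
  moreover have "s u \<le> s V" if "(u, V) \<in> H" for u using rankingD[OF s that] by simp
  ultimately show ?thesis
    by - (erule ci_map, auto intro!: determinesI simp: restrict_eq_iff \<phi>_def parents_def)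
qed

text \<open>
  Rejection sampling: in the simulation \<open>Y\<close> is drawn uniformly, and \<open>Z\<close>, which sees \<open>X\<close>, \<open>Y\<close> and
  the parents of \<open>Y\<close>, draws a flag that accepts the value of \<open>Y\<close> with its probability under \<open>p\<close>.
  The flag is handed down to all descendants of \<open>Z\<close>. Conditioning on acceptance recovers \<open>p\<close>,
  and the flag is visible at or before \<open>V\<close> because \<open>D\<close> carries it.
\<close>

lemma add_edge_collider:
  fixes G H :: "('v::finite \<times> 'v) set" and p :: "('v \<Rightarrow> 's) pmf"
  assumes G': "acyclic (insert (X, Y) G)" and XZ: "(X, Z) \<in> G" and YZ: "(Y, Z) \<in> G"
    and cov: "parents G Y \<subseteq> parents G Z"
    and le: "dag_le G H" and s: "ranking H s" and D: "(Z, D) \<in> G\<^sup>*" "s D \<le> s V"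
    and fin: "finite (set_pmf p)" and inc: "dag_includes (insert (X, Y) G) p"
  shows "ci p (\<lambda>x. x V) (\<lambda>x. restrict x {u. s u < s V}) (\<lambda>x. restrict x (parents H V))"
proof -
  let ?G' = "insert (X, Y) G"
  obtain r where r': "ranking ?G' r" using acyclic_ranking[OF G'] .
  then have r: "ranking G r" by (auto simp: ranking_def)
  have rG: "r u < r v" if "(u, v) \<in> G" for u v using rankingD[OF r that] .
  \<comment> \<open>All that the acceptance probability depends on; these variables are parents of
    \<open>Z\<close> in \<open>G\<close>.\<close>
  define W where "W = insert Y (parents ?G' Y)"
  have W: "W \<subseteq> parents G Z" using XZ YZ cov by (auto simp: W_def parents_def)
  obtain q where q: "\<And>x. pmf p x = (\<Prod>i\<in>UNIV. pmf (q i (restrict x (parents ?G' i))) (x i))"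
    and finq: "\<And>i y. finite (set_pmf (q i y))"
    using dag_includes_finite_kernels[OF G' inc fin] by blast
  define K where "K = (\<lambda>x. x Y) ` set_pmf p"
  have K: "finite K" "K \<noteq> {}" using fin set_pmf_not_empty[of p] by (auto simp: K_def)
  define q0 where "q0 v = (if v = Y then (\<lambda>_. pmf_of_set K) else q v)" for v
  have "acyclic G" using ranking_acyclic[OF r] .
  then obtain p0 where fin0: "finite (set_pmf p0)"
    and p0: "\<And>x. pmf p0 x = (\<Prod>v\<in>UNIV. pmf (q0 v (restrict x (parents G v))) (x v))"
    by (rule dag_kernels_exist[of G q0]) (use finq K in \<open>auto simp: q0_def\<close>)
  have inc0: "dag_includes G p0" unfolding dag_includes_def using p0 by blast
  define c where "c x = pmf (q Y (restrict x (parents ?G' Y))) (x Y)" for x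
  have c01: "0 \<le> c x" "c x \<le> 1" for x by (simp_all add: c_def pmf_le_1)
  have cW: "c (restrict x W) = c x" for x
  proof -
    have "restrict (restrict x W) (parents ?G' Y) = restrict x (parents ?G' Y)"
      by (auto simp: restrict_def W_def)
    then show ?thesis by (simp add: c_def W_def)
  qed
  \<comment> \<open>Proposal mass times acceptance probability is \<open>p\<close> up to the factor
    \<open>1 / card K\<close>; if \<open>x Y\<close> is outside \<open>K\<close>, both sides are
    0.\<close>
  have p_eq: "pmf p0 x * c x = pmf p x / real (card K)" for x
  proof -
    have rest: "(\<Prod>v\<in>UNIV - {Y}. pmf (q0 v (restrict x (parents G v))) (x v)) =
        (\<Prod>v\<in>UNIV - {Y}. pmf (q v (restrict x (parents ?G' v))) (x v))" (is "?a = ?b")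
      by (rule prod.cong) (auto simp: q0_def parents_def)
    have "pmf p0 x = pmf (pmf_of_set K) (x Y) * ?b"
      unfolding p0 rest[symmetric] by (subst prod.remove[of _ Y]) (simp_all add: q0_def)
    moreover have px: "pmf p x = c x * ?b"
      unfolding q c_def by (subst prod.remove[of _ Y]) simp_all
    moreover have "x Y \<in> K" if "pmf p x \<noteq> 0"
      using that by (auto simp: K_def set_pmf_iff)
    ultimately show ?thesis using K by (cases "x Y \<in> K") (auto simp: pmf_of_set)
  qed
  define Q where "Q = bind_pmf p0 (\<lambda>x. map_pmf (Pair x) (bernoulli_pmf (c x)))"
  \<comment> \<open>The accepted part of \<open>Q\<close> is a scaled copy of
    \<open>p\<close>.\<close>
  have Q_True: "measure_pmf.prob Q {z. R (fst z) \<and> snd z} = measure_pmf.prob p {x. R x} / real (card K)" for R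
  proof -
    have "emeasure (measure_pmf Q) {z. R (fst z) \<and> snd z} =
        (\<integral>\<^sup>+x. emeasure (measure_pmf (bernoulli_pmf (c x))) {e. R x \<and> e} \<partial>measure_pmf p0)"
      by (simp add: Q_def vimage_def)
    also have "\<dots> = (\<integral>\<^sup>+x. ennreal (c x) * indicator {x. R x} x \<partial>measure_pmf p0)"
    proof (rule nn_integral_cong)
      fix x
      have "emeasure (measure_pmf (bernoulli_pmf (c x))) {True} = ennreal (c x)"
        using c01[of x] by (simp add: emeasure_pmf_single)
      moreover have "{e. R x \<and> e} = (if R x then {True} else {})" by auto
      ultimately show "emeasure (measure_pmf (bernoulli_pmf (c x))) {e. R x \<and> e} = ennreal (c x) * indicator {x. R x} x"
        by simp
    qed
    also have "\<dots> = (\<integral>\<^sup>+x. ennreal (pmf p0 x) * (ennreal (c x) * indicator {x. R x} x) \<partial>count_space UNIV)"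
      by (rule nn_integral_measure_pmf)
    also have "\<dots> = (\<integral>\<^sup>+x. ennreal (1 / real (card K)) * (ennreal (pmf p x) * indicator {x. R x} x) \<partial>count_space UNIV)"
    proof (rule nn_integral_cong)
      fix x
      have "ennreal (pmf p0 x) * ennreal (c x) = ennreal (1 / real (card K)) * ennreal (pmf p x)"
        using p_eq[of x] c01[of x] by (simp add: ennreal_mult[symmetric])
      then show "ennreal (pmf p0 x) * (ennreal (c x) * indicator {x. R x} x) =
          ennreal (1 / real (card K)) * (ennreal (pmf p x) * indicator {x. R x} x)"
        by (simp add: mult.assoc[symmetric])
    qed
    also have "\<dots> = ennreal (1 / real (card K)) * emeasure (measure_pmf p) {x. R x}"
      by (subst nn_integral_cmult) (simp_all add: nn_integral_measure_pmf[symmetric])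
    finally show ?thesis
      by (simp add: measure_pmf.emeasure_eq_measure ennreal_mult[symmetric] measure_nonneg)
  qed
  have "Q = bind_pmf p0 (\<lambda>x. map_pmf (Pair x) ((\<lambda>y. bernoulli_pmf (c y)) (restrict x W)))"
    by (simp add: Q_def cW)
  then have flag: "ci Q snd fst ((\<lambda>x. restrict x W) \<circ> fst)"
    using ci_kernel[of p0 "\<lambda>y. bernoulli_pmf (c y)" "\<lambda>x. restrict x W"] by simp
  have fstQ: "map_pmf fst Q = p0"
    by (simp add: Q_def map_bind_pmf pmf.map_comp o_def bind_return_pmf')
  have finQ: "finite (set_pmf Q)" using fin0 by (auto simp: Q_def)
  have base: "ci Q (\<lambda>z. fst z v) (\<lambda>z. restrict (fst z) {u. r u < r v}) (\<lambda>z. restrict (fst z) (parents G v))" for v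
    using ranking_ci[OF r inc0, of v] unfolding fstQ[symmetric] ci_map_pmf o_def .
  define De where "De = {w. (Z, w) \<in> G\<^sup>*}"
  have De: "w \<in> De" if "(u, w) \<in> G" "u \<in> De" for u w
    using that by (auto simp: De_def intro: rtrancl_into_rtrancl)
  have De_rank: "r Z \<le> r v" if "v \<in> De" for v
    using that ranking_rtrancl[OF r] by (auto simp: De_def)
  define enr where "enr z v = (fst z v, snd z \<and> v \<in> De)" for z :: "('v \<Rightarrow> 's) \<times> bool" and v
  have "dag_includes G (map_pmf enr Q)"
  proof (rule dag_includesI[OF r])
    fix v
    let ?A = "{u. r u < r v}" and ?S = "parents G v"
    have SA: "?S \<subseteq> ?A" using rG by (auto simp: parents_def)
    \<comment> \<open>Before \<open>Z\<close> no flag is visible; at \<open>Z\<close> it is drawn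
      along with the value; after \<open>Z\<close> a descendant of \<open>Z\<close> reads it from a
      parent that is \<open>Z\<close> or a descendant of \<open>Z\<close>.\<close>
    consider "r v < r Z" | "v = Z" | "r Z < r v"
      using r by (metis injD linorder_neqE_nat ranking_def)
    then show "ci (map_pmf enr Q) (\<lambda>x. x v) (\<lambda>x. restrict x ?A) (\<lambda>x. restrict x ?S)"
    proof cases
      case 1
      then have "u \<notin> De" if "r u \<le> r v" for u using De_rank[of u] that by auto
      then have "u \<notin> De" if "r u < r v \<or> u = v \<or> u \<in> parents G v" for u
        using that SA by force
      then show ?thesis unfolding ci_map_pmf
        by (intro ci_map[OF base[of v]])
          (use SA in \<open>auto intro!: determinesI simp: restrict_eq_iff enr_def subset_iff\<close>)
    next
      case 2
      have nDe: "u \<notin> De" if "r u < r v" for u using De_rank[of u] that 2 by auto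
      have "ci Q snd (\<lambda>z. restrict (fst z) ?A) (\<lambda>z. (fst z v, restrict (fst z) ?S))"
        by (rule ci_map[OF flag]) (use W 2 in \<open>auto intro!: determinesI simp: restrict_eq_iff subset_iff\<close>)
      from ci_contraction[OF finQ ci_sym[OF base[of v]] ci_sym[OF this]]
      have "ci Q (\<lambda>z. (fst z v, snd z)) (\<lambda>z. restrict (fst z) ?A) (\<lambda>z. restrict (fst z) ?S)"
        by (rule ci_sym)
      then show ?thesis unfolding ci_map_pmf
        by (rule ci_map)
          (use SA nDe in \<open>auto intro!: determinesI simp: restrict_eq_iff enr_def subset_iff\<close>)
    next
      case 3
      have WA: "W \<subseteq> ?A"
      proof
        fix w assume "w \<in> W"
        then have "(w, Z) \<in> G" using W by (auto simp: parents_def)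
        then show "w \<in> ?A" using rG[of w Z] 3 by simp
      qed
      have "ci Q snd (\<lambda>z. fst z v) (\<lambda>z. (restrict (fst z) ?A, restrict (fst z) ?S))"
        by (rule ci_map[OF flag]) (use WA in \<open>auto intro!: determinesI simp: restrict_eq_iff subset_iff\<close>)
      from ci_contraction[OF finQ base[of v] ci_sym[OF this]]
      have c: "ci Q (\<lambda>z. fst z v) (\<lambda>z. (restrict (fst z) ?A, snd z)) (\<lambda>z. restrict (fst z) ?S)" .
      have par: "\<exists>u. (u, v) \<in> G \<and> u \<in> De" if "v \<in> De"
      proof -
        have "(Z, v) \<in> G\<^sup>*" "v \<noteq> Z" using that 3 by (auto simp: De_def)
        then show ?thesis by (cases rule: rtranclE) (auto simp: De_def)
      qed
      have flag_par: "snd z = snd z'" if "\<forall>u\<in>?S. enr z u = enr z' u" "v \<in> De" for z z'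
        using par[OF that(2)] that(1) by (auto simp: parents_def enr_def)
      have "enr z v = enr z' v" if "fst z v = fst z' v" "\<forall>u\<in>?S. enr z u = enr z' u" for z z'
        using that(1) flag_par[OF that(2)] by (cases "v \<in> De") (simp_all add: enr_def)
      then have "determines Q (\<lambda>z. (fst z v, ((\<lambda>x. restrict x ?S) \<circ> enr) z)) ((\<lambda>x. x v) \<circ> enr)"
        unfolding determines_def restrict_eq_iff o_def prod.inject by blast
      then show ?thesis unfolding ci_map_pmf
        by (intro ci_map[OF c])
          (use SA in \<open>auto intro!: determinesI simp: restrict_eq_iff enr_def subset_iff\<close>)
    qed
  qed (use finQ in simp)
  then have "dag_includes H (map_pmf enr Q)"
    by (intro dag_le_transfer[OF ranking_acyclic[OF r] ranking_acyclic[OF s] le]) (use finQ in simp_all)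
  from ranking_ci[OF s this, of V]
  have enr: "ci Q (\<lambda>z. enr z V) (\<lambda>z. restrict (enr z) {u. s u < s V}) (\<lambda>z. restrict (enr z) (parents H V))"
    unfolding ci_map_pmf o_def .
  have DDe: "D \<in> De" using D by (simp add: De_def)
  let ?f = "\<lambda>z. fst z V" and ?g = "\<lambda>z. restrict (fst z) {u. s u < s V}"
    and ?h = "\<lambda>z. (restrict (fst z) (parents H V), snd z)"
  \<comment> \<open>Weak union moves the flag into the condition: its carrier \<open>D\<close> is
    either \<open>V\<close> itself or a predecessor of \<open>V\<close>.\<close>
  have "ci Q ?f ?g ?h"
  proof (cases "D = V")
    case True
    show ?thesis
      by (rule ci_sym, rule ci_map[OF ci_sym[OF enr]])
        (use True DDe in \<open>auto intro!: determinesI simp: restrict_eq_iff enr_def\<close>)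
  next
    case False
    then have "s D < s V" using D s by (metis injD le_neq_implies_less ranking_def)
    then show ?thesis
      by (intro ci_map[OF enr])
        (use DDe in \<open>auto intro!: determinesI simp: restrict_eq_iff enr_def\<close>)
  qed
  \<comment> \<open>With the flag fixed to \<open>True\<close>, all four probabilities concern the
    accepted part, and the scaling factors cancel.\<close>
  note ci_True = ciD[OF this, of _ _ "(c, True)" for c]
  show ?thesis
    unfolding ci_def
  proof (intro allI)
    fix A B c
    have k: "card K \<noteq> 0" using K by simp
    have "measure_pmf.prob Q {z. (fst z V \<in> A \<and> restrict (fst z) {u. s u < s V} \<in> B \<and> restrict (fst z) (parents H V) = c) \<and> snd z} *
        measure_pmf.prob Q {z. restrict (fst z) (parents H V) = c \<and> snd z} =
        measure_pmf.prob Q {z. (fst z V \<in> A \<and> restrict (fst z) (parents H V) = c) \<and> snd z} *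
        measure_pmf.prob Q {z. (restrict (fst z) {u. s u < s V} \<in> B \<and> restrict (fst z) (parents H V) = c) \<and> snd z}"
      using ci_True[of A B c] by (simp add: conj_assoc)
    then show "measure_pmf.prob p {x. x V \<in> A \<and> restrict x {u. s u < s V} \<in> B \<and> restrict x (parents H V) = c} *
        measure_pmf.prob p {x. restrict x (parents H V) = c} =
        measure_pmf.prob p {x. x V \<in> A \<and> restrict x (parents H V) = c} *
        measure_pmf.prob p {x. restrict x {u. s u < s V} \<in> B \<and> restrict x (parents H V) = c}"
      unfolding Q_True[of "\<lambda>x. x V \<in> A \<and> restrict x {u. s u < s V} \<in> B \<and> restrict x (parents H V) = c"]
        Q_True[of "\<lambda>x. restrict x (parents H V) = c"]
        Q_True[of "\<lambda>x. x V \<in> A \<and> restrict x (parents H V) = c"]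
        Q_True[of "\<lambda>x. restrict x {u. s u < s V} \<in> B \<and> restrict x (parents H V) = c"]
      using k by simp
  qed
qed

section \<open>Existence of an edge deletion between comparable models\<close>

lemma dag_equiv_refl: "dag_equiv G G"
  by (simp add: dag_equiv_def dag_le_refl)

lemma dag_equiv_sym: "dag_equiv G H \<Longrightarrow> dag_equiv H G"
  by (simp add: dag_equiv_def)

lemma dag_equiv_trans: "dag_equiv G H \<Longrightarrow> dag_equiv H K \<Longrightarrow> dag_equiv G K"
  unfolding dag_equiv_def by (blast intro: dag_le_trans)

lemma ci_restrict_superset:
  assumes "ci p (\<lambda>x. x v) (\<lambda>x. restrict x A) (\<lambda>x. restrict x S)" "S \<subseteq> S'" "S' \<subseteq> A"
  shows "ci p (\<lambda>x. x v) (\<lambda>x. restrict x A) (\<lambda>x. restrict x S')"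
proof (rule ci_map[OF assms(1)])
  have "\<forall>a\<in>S'. x a = y a" if "\<forall>a\<in>A. x a = y a" for x y :: "'a \<Rightarrow> 'b"
    using that assms(3) by blast
  then show "determines p (\<lambda>x. (restrict x A, restrict x S)) (\<lambda>x. restrict x S')"
    unfolding determines_def restrict_eq_iff prod.inject by blast
  have "\<forall>a\<in>S. x a = y a" if "\<forall>a\<in>S'. x a = y a" for x y :: "'a \<Rightarrow> 'b"
    using that assms(2) by blast
  then show "determines p (\<lambda>x. restrict x S') (\<lambda>x. restrict x S)"
    unfolding determines_def restrict_eq_iff by blast
qed (auto intro!: determinesI)

text \<open>
  The second conjunct keeps the set of the agreeing variables closed under children, so that the
  remaining variables form an ancestral set.
\<close>

definition agrees_from :: "('v \<times> 'v) set \<Rightarrow> ('v \<times> 'v) set \<Rightarrow> ('v \<Rightarrow> nat) \<Rightarrow> nat \<Rightarrow> bool" where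
  "agrees_from G H s k \<longleftrightarrow>
     (\<forall>v. k \<le> s v \<longrightarrow> parents G v = parents H v \<and> (\<forall>w. (v, w) \<in> G \<longrightarrow> k \<le> s w))"

lemma agrees_from_parents: "agrees_from G H s k \<Longrightarrow> k \<le> s v \<Longrightarrow> parents G v = parents H v"
  by (simp add: agrees_from_def)

lemma agrees_from_edge: "agrees_from G H s (Suc k) \<Longrightarrow> (u, v) \<in> G \<Longrightarrow> s v \<le> k \<Longrightarrow> s u \<le> k"
  unfolding agrees_from_def by (meson not_less_eq_eq)

lemma agrees_from_rtrancl:
  assumes "agrees_from G H s (Suc k)" "(u, v) \<in> G\<^sup>*" "s v \<le> k"
  shows "s u \<le> k"
  using assms(2,3) by (induction rule: converse_rtrancl_induct) (auto dest: agrees_from_edge[OF assms(1)])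

text \<open>Only ranks up to \<open>k\<close> need an argument. Above \<open>k\<close> the parents
  are those in \<open>H\<close>, and the predecessors in \<open>s\<close> stay ancestral because the
  new edge lies inside the lower part.\<close>

lemma dag_le_insert_edgeI:
  fixes G H :: "('v::finite \<times> 'v) set"
  assumes agr: "agrees_from G H s (Suc k)" and s: "ranking H s"
    and ac: "acyclic (insert (a, b) G)" and ab: "s a \<le> k" "s b \<le> k"
    and ci: "\<And>p V. finite (set_pmf p) \<Longrightarrow> dag_includes (insert (a, b) G) p \<Longrightarrow> s V \<le> k \<Longrightarrow>
      ci (p :: ('v \<Rightarrow> nat) pmf) (\<lambda>x. x V) (\<lambda>x. restrict x {u. s u < s V}) (\<lambda>x. restrict x (parents H V))"
  shows "dag_le (insert (a, b) G) H"
  unfolding dag_le_def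
proof (intro allI impI)
  let ?G' = "insert (a, b) G"
  fix p :: "('v \<Rightarrow> nat) pmf"
  assume fin: "finite (set_pmf p)" and inc: "dag_includes ?G' p"
  show "dag_includes H p"
  proof (rule dag_includesI[OF s fin])
    fix V
    show "ci p (\<lambda>x. x V) (\<lambda>x. restrict x {u. s u < s V}) (\<lambda>x. restrict x (parents H V))"
    proof (cases "s V \<le> k")
      case True
      then show ?thesis by (rule ci[OF fin inc])
    next
      case False
      then have "parents ?G' V = parents G V" using ab by (auto simp: parents_def)
      then have par: "parents ?G' V = parents H V"
        using agrees_from_parents[OF agr] False by auto
      have below: "s u < s V" if e: "(u, w) \<in> ?G'" and w: "s w < s V" for u w
      proof (cases "s w \<le> k")
        case True
        then have "s u \<le> k" using e ab agrees_from_edge[OF agr, of u w] by auto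
        then show ?thesis using False by simp
      next
        case False
        then have "(u, w) \<in> G" using e ab by auto
        then have "(u, w) \<in> H"
          using agrees_from_parents[OF agr, of w] False by (auto simp: parents_def)
        then show ?thesis using rankingD[OF s] w less_trans by blast
      qed
      then have anc: "ancestral ?G' {u. s u < s V}" unfolding ancestral_def by blast
      show ?thesis
        unfolding par[symmetric]
        by (rule dag_includes_ci[OF ac inc anc])
          (use par in \<open>auto simp: parents_def dest: rankingD[OF s]\<close>)
    qed
  qed
qed

text \<open>Quantified over the whole equivalence class of \<open>G\<close>, so that it stays usable
  after reversals of covered edges.\<close>

definition edge_maximal_below :: "('v::finite \<times> 'v) set \<Rightarrow> ('v \<times> 'v) set \<Rightarrow> bool" where
  "edge_maximal_below G H \<longleftrightarrow>
     (\<forall>K a b. acyclic K \<longrightarrow> dag_equiv K G \<longrightarrow> (a, b) \<notin> K \<longrightarrow> acyclic (insert (a, b) K) \<longrightarrow>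
        \<not> dag_le (insert (a, b) K) H)"

text \<open>Induction on the number of proper descendants of \<open>Y\<close> ranked at most
  \<open>s Y\<close>. If there are none, the parents of \<open>Y\<close> must be those in
  \<open>H\<close>; otherwise reversing a covered edge out of \<open>Y\<close> lowers the
  number.\<close>

lemma agrees_from_step:
  fixes G H K :: "('v::finite \<times> 'v) set"
  assumes le: "dag_le G H" and stuck: "edge_maximal_below G H" and s: "ranking H s"
    and K: "acyclic K" "dag_equiv K G" "agrees_from K H s (Suc (s Y))"
  shows "\<exists>L. acyclic L \<and> dag_equiv L G \<and> agrees_from L H s (s Y)"
  using K
proof (induction "card {w. (Y, w) \<in> K\<^sup>+ \<and> s w \<le> s Y}" arbitrary: K rule: less_induct)
  case less
  note ac = less.prems(1) and eq = less.prems(2) and agr = less.prems(3)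
  have KH: "dag_le K H" using eq le by (auto simp: dag_equiv_def intro: dag_le_trans)
  have no_edge: "\<not> dag_le (insert (a, b) K) H" if "(a, b) \<notin> K" "acyclic (insert (a, b) K)" for a b
    using stuck ac eq that by (auto simp: edge_maximal_below_def)
  have inj: "s u = s v \<longleftrightarrow> u = v" for u v using s by (auto simp: ranking_def inj_def)
  obtain r where r: "ranking K r" using acyclic_ranking[OF ac] .
  have irr: "(v, v) \<notin> K\<^sup>+" for v using ac by (simp add: acyclic_def)
  show ?case
  proof (cases "{w. (Y, w) \<in> K\<^sup>+ \<and> s w \<le> s Y} = {}")
    case True
    then have desc: "s Y < s w" if "(Y, w) \<in> K\<^sup>+" for w using that by force
    have parY: "s u < s Y" if "(u, Y) \<in> K" for u
    proof -
      have "s u \<le> s Y" using agrees_from_edge[OF agr that] by simp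
      moreover have "u \<noteq> Y" using that irr[of Y] by auto
      ultimately show ?thesis using inj[of u Y] by simp
    qed
    have sub: "parents K Y \<subseteq> parents H Y"
      using dag_le_edge[OF ac _ KH s] parY by (auto simp: parents_def)
    \<comment> \<open>A missing parent could be added below \<open>H\<close>, against
      maximality.\<close>
    have "parents H Y \<subseteq> parents K Y"
    proof
      fix x assume x: "x \<in> parents H Y"
      show "x \<in> parents K Y"
      proof (rule ccontr)
        assume nx: "x \<notin> parents K Y"
        let ?K' = "insert (x, Y) K"
        have sx: "s x < s Y" using x rankingD[OF s] by (auto simp: parents_def)
        have "(Y, x) \<notin> K\<^sup>*" using sx desc[of x] by (auto simp: rtrancl_eq_or_trancl)
        then have ac': "acyclic ?K'" using ac by (simp add: acyclic_insert)
        have "dag_le ?K' H"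
        proof (rule dag_le_insert_edgeI[OF agr s ac'])
          fix p :: "('v \<Rightarrow> nat) pmf" and V
          assume fin: "finite (set_pmf p)" and inc: "dag_includes ?K' p" and V: "s V \<le> s Y"
          show "ci p (\<lambda>x. x V) (\<lambda>x. restrict x {u. s u < s V}) (\<lambda>x. restrict x (parents H V))"
          proof (cases "V = Y")
            case True
            \<comment> \<open>\<open>Y\<close> has no child among the lower variables, so its
              predecessors in \<open>s\<close> are ancestral even in the enlarged graph.\<close>
            have "ci p (\<lambda>x. x Y) (\<lambda>x. restrict x {u. s u < s Y}) (\<lambda>x. restrict x (parents ?K' Y))"
            proof (rule dag_includes_ci[OF ac' inc])
              have "s u < s Y" if "(u, w) \<in> K" "s w < s Y" for u w
              proof -
                have "s u \<le> s Y" using agrees_from_edge[OF agr that(1)] that(2) by simp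
                moreover have "u \<noteq> Y" using desc[of w] that by auto
                ultimately show ?thesis using inj[of u Y] by simp
              qed
              then show "ancestral ?K' {u. s u < s Y}" by (auto simp: ancestral_def)
              show "parents ?K' Y \<subseteq> {u. s u < s Y}" using parY sx by (auto simp: parents_def)
            qed simp
            then show ?thesis
              unfolding True by (rule ci_restrict_superset)
                (use sub x in \<open>auto simp: parents_def dest: rankingD[OF s]\<close>)
          next
            case False
            then have "s V < s Y" using V inj[of V Y] by simp
            then show ?thesis
              by (intro add_edge_nondescendants[OF ac' KH s _ fin inc])
                (auto simp: rtrancl_eq_or_trancl dest: desc)
          qed
        qed (use sx in simp_all)
        then show False using no_edge[of x Y] nx ac' by (simp add: parents_def)
      qed
    qed
    then have "parents K Y = parents H Y" using sub by auto
    moreover have "Suc (s Y) \<le> s v" if "s Y \<le> s v" "v \<noteq> Y" for v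
      using that inj[of v Y] by simp
    ultimately have "agrees_from K H s (s Y)"
      using agr desc unfolding agrees_from_def by (metis Suc_leD less_imp_le r_into_trancl')
    then show ?thesis using ac eq by blast
  next
    case False
    \<comment> \<open>The descendant of \<open>Y\<close> that comes first in the order of
      \<open>H\<close>: every \<open>V\<close> before it also comes before all descendants of
      \<open>Y\<close>.\<close>
    obtain D where D: "(Y, D) \<in> K\<^sup>+" "s D \<le> s Y"
      and D_min: "\<And>w. (Y, w) \<in> K\<^sup>+ \<Longrightarrow> s w \<le> s Y \<Longrightarrow> s D \<le> s w"
    proof -
      obtain w where "(Y, w) \<in> K\<^sup>+ \<and> s w \<le> s Y" using False by blast
      from ex_has_least_nat[of "\<lambda>w. (Y, w) \<in> K\<^sup>+ \<and> s w \<le> s Y", OF this, of s]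
      show ?thesis using that by blast
    qed
    \<comment> \<open>The child of \<open>Y\<close> leading to \<open>D\<close> that is earliest in
      an order of \<open>K\<close>, so that no other parent of \<open>Z\<close> descends from
      \<open>Y\<close>.\<close>
    obtain Z where Z: "(Y, Z) \<in> K" "(Z, D) \<in> K\<^sup>*"
      and Z_min: "\<And>c. (Y, c) \<in> K \<Longrightarrow> (c, D) \<in> K\<^sup>* \<Longrightarrow> r Z \<le> r c"
    proof -
      obtain c where "(Y, c) \<in> K \<and> (c, D) \<in> K\<^sup>*" using tranclD[OF D(1)] by blast
      from ex_has_least_nat[of "\<lambda>c. (Y, c) \<in> K \<and> (c, D) \<in> K\<^sup>*", OF this, of r]
      show ?thesis using that by blast
    qed
    have sZ: "s Z \<le> s Y" using agrees_from_rtrancl[OF agr Z(2) D(2)] .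
    \<comment> \<open>A parent of \<open>Y\<close> missing at \<open>Z\<close> could be added there,
      as \<open>Y\<close> can pass on a copy of it.\<close>
    have sub1: "parents K Y \<subseteq> parents K Z"
    proof
      fix x assume "x \<in> parents K Y"
      then have xY: "(x, Y) \<in> K" by (simp add: parents_def)
      show "x \<in> parents K Z"
      proof (rule ccontr)
        assume nx: "x \<notin> parents K Z"
        have "r x < r Z" using rankingD[OF r xY] rankingD[OF r Z(1)] by simp
        then have "(Z, x) \<notin> K\<^sup>*" using ranking_rtrancl[OF r, of Z x] by auto
        then have ac': "acyclic (insert (x, Z) K)" using ac by (simp add: acyclic_insert)
        have "dag_le (insert (x, Z) K) H"
        proof (rule dag_le_insert_edgeI[OF agr s ac'])
          show "s x \<le> s Y" using agrees_from_edge[OF agr xY] by simp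
        qed (use sZ in \<open>auto intro: add_edge_to_child[OF ac xY Z(1) KH s]\<close>)
        then show False using no_edge[of x Z] nx ac' by (simp add: parents_def)
      qed
    qed
    \<comment> \<open>A further parent of \<open>Z\<close> could be added at \<open>Y\<close>: for
      \<open>V\<close> before \<open>D\<close> the descendants of \<open>Y\<close> are erased, from
      \<open>D\<close> on rejection sampling applies.\<close>
    have sub2: "parents K Z \<subseteq> insert Y (parents K Y)"
    proof
      fix x assume "x \<in> parents K Z"
      then have xZ: "(x, Z) \<in> K" by (simp add: parents_def)
      show "x \<in> insert Y (parents K Y)"
      proof (rule ccontr)
        assume nx: "x \<notin> insert Y (parents K Y)"
        \<comment> \<open>A path from \<open>Y\<close> to \<open>x\<close> would start with a child
          of \<open>Y\<close> that is earlier than \<open>Z\<close> and also leads to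
          \<open>D\<close>.\<close>
        have "(Y, x) \<notin> K\<^sup>*"
        proof
          assume "(Y, x) \<in> K\<^sup>*"
          then obtain c where c: "(Y, c) \<in> K" "(c, x) \<in> K\<^sup>*"
            using nx by (auto elim: converse_rtranclE)
          then have "(c, D) \<in> K\<^sup>*" using xZ Z(2) by (meson converse_rtrancl_into_rtrancl rtrancl_trans)
          then have "r Z \<le> r c" by (rule Z_min[OF c(1)])
          then show False using ranking_rtrancl[OF r c(2)] rankingD[OF r xZ] by simp
        qed
        then have ac': "acyclic (insert (x, Y) K)" using ac by (simp add: acyclic_insert)
        have "dag_le (insert (x, Y) K) H"
        proof (rule dag_le_insert_edgeI[OF agr s ac'])
          show "s x \<le> s Y" using agrees_from_edge[OF agr xZ sZ] .
          fix p :: "('v \<Rightarrow> nat) pmf" and V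
          assume fin: "finite (set_pmf p)" and inc: "dag_includes (insert (x, Y) K) p" and V: "s V \<le> s Y"
          show "ci p (\<lambda>x. x V) (\<lambda>x. restrict x {u. s u < s V}) (\<lambda>x. restrict x (parents H V))"
          proof (cases "s D \<le> s V")
            case True
            show ?thesis
              by (rule add_edge_collider[OF ac' xZ Z(1) sub1 KH s Z(2) True fin inc])
          next
            case False
            have "s V < s u" if "(Y, u) \<in> K\<^sup>*" for u
              using that False D(2) D_min[of u] V by (cases "s u \<le> s Y") (auto simp: rtrancl_eq_or_trancl)
            then show ?thesis
              by (rule add_edge_nondescendants[OF ac' KH s _ fin inc])
          qed
        qed simp
        then show False using no_edge[of x Y] nx ac' by (simp add: parents_def)
      qed
    qed
    have cov: "parents K Z = insert Y (parents K Y)"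
      using sub1 sub2 Z(1) by (auto simp: parents_def)
    define K2 where "K2 = insert (Z, Y) (K - {(Y, Z)})"
    have ac2: "acyclic K2" and eq2: "dag_equiv K K2"
      unfolding K2_def by (rule covered_reversal[OF ac Z(1) cov])+
    have "agrees_from K2 H s (Suc (s Y))"
      using agr sZ by (auto simp: agrees_from_def K2_def parents_def)
    moreover have "dag_equiv K2 G"
      using dag_equiv_trans[OF dag_equiv_sym[OF eq2] eq] .
    \<comment> \<open>The reversal creates no new descendants of \<open>Y\<close> and removes
      \<open>Z\<close>.\<close>
    moreover have "card {w. (Y, w) \<in> K2\<^sup>+ \<and> s w \<le> s Y} < card {w. (Y, w) \<in> K\<^sup>+ \<and> s w \<le> s Y}"
    proof (rule psubset_card_mono)
      have reach: "(Y, w) \<in> K\<^sup>*" if "(Y, w) \<in> K2\<^sup>*" for w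
        using that by (induction rule: rtrancl_induct) (auto simp: K2_def intro: rtrancl_into_rtrancl)
      have irr2: "(v, v) \<notin> K2\<^sup>+" for v using ac2 by (simp add: acyclic_def)
      have "(Y, w) \<in> K\<^sup>+" if "(Y, w) \<in> K2\<^sup>+" for w
        using reach[OF trancl_into_rtrancl[OF that]] that irr2[of Y] by (auto simp: rtrancl_eq_or_trancl)
      moreover have "(Y, Z) \<notin> K2\<^sup>+"
        using irr2[of Y] trancl_into_trancl[of Y Z K2 Y] by (auto simp: K2_def)
      ultimately show "{w. (Y, w) \<in> K2\<^sup>+ \<and> s w \<le> s Y} \<subset> {w. (Y, w) \<in> K\<^sup>+ \<and> s w \<le> s Y}"
        using Z(1) sZ by auto
    qed simp
    ultimately show ?thesis using less.hyps ac2 by blast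
  qed
qed

lemma edge_maximal_below_equiv:
  fixes G H :: "('v::finite \<times> 'v) set"
  assumes "acyclic G" "acyclic H" and le: "dag_le G H" and stuck: "edge_maximal_below G H"
  shows "dag_equiv G H"
proof -
  obtain s where s: "ranking H s" using acyclic_ranking[OF assms(2)] .
  obtain n where n: "\<And>v. s v < n"
    using finite_nat_set_iff_bounded[of "range s"] by auto
  \<comment> \<open>The threshold of agreement descends from \<open>n\<close>, where it is vacuous,
    to 0, where it means \<open>K = H\<close>.\<close>
  have "\<exists>K. acyclic K \<and> dag_equiv K G \<and> agrees_from K H s (n - i)" for i
  proof (induction i)
    case 0
    have "\<not> n \<le> s v" for v using n[of v] by simp
    then show ?case using assms(1) by (auto intro!: exI[of _ G] simp: agrees_from_def dag_equiv_refl)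
  next
    case (Suc i)
    then obtain K where K: "acyclic K" "dag_equiv K G" "agrees_from K H s (n - i)" by blast
    show ?case
    proof (cases "\<exists>Y. n - i = Suc (s Y)")
      case True
      then obtain Y where Y: "n - i = Suc (s Y)" by blast
      then have "n - Suc i = s Y" by simp
      then show ?thesis using agrees_from_step[OF le stuck s K(1,2)] K(3) Y by simp
    next
      \<comment> \<open>Either no variable has rank \<open>n - Suc i\<close> or the threshold is 0
        already; the same \<open>K\<close> serves.\<close>
      case False
      then have "n - i \<le> s v \<longleftrightarrow> n - Suc i \<le> s v" for v
        by (metis Suc_diff_Suc diff_is_0_eq le_antisym le_less not_less not_less_eq_eq zero_le)
      then show ?thesis using K by (auto simp: agrees_from_def)
    qed
  qed
  from this[of n] obtain K where K: "dag_equiv K G" "agrees_from K H s 0" by auto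
  then have "parents K v = parents H v" for v by (simp add: agrees_from_def)
  then have "K = H" by (auto simp: parents_def set_eq_iff)
  then show ?thesis using K dag_equiv_sym by blast
qed

text \<open>Meek's conjecture, read from above. A highest model strictly below \<open>H\<close> and
  above \<open>G\<close> is not edge-maximal below \<open>H\<close>, and by its height an edge added
  below \<open>H\<close> must reach the class of \<open>H\<close>.\<close>

theorem dag_less_edge_deletion:
  fixes G H :: "('v::finite \<times> 'v) set"
  assumes G: "acyclic G" and H: "acyclic H" and less: "dag_less G H"
  obtains K a b where "acyclic K" "(a, b) \<notin> K" "acyclic (insert (a, b) K)"
    "dag_equiv (insert (a, b) K) H" "dag_le G K"
proof -
  \<comment> \<open>Candidates between the two models. Height is the number of graphs below a model,
    which grows strictly along strict inclusion.\<close>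
  let ?I = "{K. acyclic K \<and> dag_le G K \<and> dag_le K H \<and> \<not> dag_le H K}"
  have "G \<in> ?I" using G less dag_le_refl by (auto simp: dag_less_def dag_equiv_def)
  then have "Max ((\<lambda>L. card {M. dag_le M L}) ` ?I) \<in> (\<lambda>L. card {M. dag_le M L}) ` ?I"
    by (intro Max_in) auto
  then obtain K where K: "K \<in> ?I"
    and max: "card {M. dag_le M K} = Max ((\<lambda>L. card {M. dag_le M L}) ` ?I)"
    by (elim imageE) simp
  have K_max: "card {M. dag_le M L} \<le> card {M. dag_le M K}" if "L \<in> ?I" for L
    unfolding max by (rule Max_ge) (use that in auto)
  have "\<not> edge_maximal_below K H"
    using edge_maximal_below_equiv[of K H] H K by (auto simp: dag_equiv_def)
  then obtain L a b where L: "acyclic L" "dag_equiv L K" "(a, b) \<notin> L" "acyclic (insert (a, b) L)"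
    and L_le: "dag_le (insert (a, b) L) H"
    by (auto simp: edge_maximal_below_def)
  let ?L' = "insert (a, b) L"
  have GL: "dag_le G L" using K L(2) by (auto simp: dag_equiv_def intro: dag_le_trans)
  have KL': "dag_le K ?L'"
    using L(2) dag_le_subset[of L ?L'] by (auto simp: dag_equiv_def intro: dag_le_trans)
  have "dag_le H ?L'"
  proof (rule ccontr)
    assume "\<not> dag_le H ?L'"
    then have "?L' \<in> ?I" using L(4) L_le K KL' by (auto intro: dag_le_trans)
    then have "card {M. dag_le M ?L'} \<le> card {M. dag_le M K}" by (rule K_max)
    moreover have "{M. dag_le M K} \<subseteq> {M. dag_le M ?L'}" using KL' by (auto intro: dag_le_trans)
    ultimately have "{M. dag_le M K} = {M. dag_le M ?L'}" by (intro card_seteq) auto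
    then have "dag_le ?L' K" using dag_le_refl by blast
    then have "dag_le ?L' L" using L(2) by (auto simp: dag_equiv_def intro: dag_le_trans)
    then show False using not_dag_le_insert_edge[OF L(4,3)] by simp
  qed
  then have "dag_equiv ?L' H" using L_le by (simp add: dag_equiv_def)
  then show ?thesis using that L GL by blast
qed

section \<open>Greedy search\<close>

text \<open>Dividing by the mass of the configuration relates the two forms; on null configurations
  \<open>ci\<close> reads 0 = 0. Preimages are closed under intersection, so checking them suffices
  for the generated sigma-algebras.\<close>

lemma cond_indep_iff_ci:
  "cond_indep p A B C \<longleftrightarrow> ci p (\<lambda>x. restrict x A) (\<lambda>x. restrict x B) (\<lambda>x. restrict x C)"
proof
  let ?f = "\<lambda>x. restrict x A" and ?g = "\<lambda>x. restrict x B" and ?h = "\<lambda>x. restrict x C"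
  let ?P = "measure_pmf.prob p"
  have cond: "measure_pmf.prob (cond_pmf p {x. ?h x = ?h z}) U =
      ?P (U \<inter> {x. ?h x = ?h z}) / ?P {x. ?h x = ?h z}"
    and pos: "?P {x. ?h x = ?h z} \<noteq> 0" if "z \<in> set_pmf p" for z U
  proof -
    have ne: "set_pmf p \<inter> {x. ?h x = ?h z} \<noteq> {}" using that by blast
    then show "measure_pmf.prob (cond_pmf p {x. ?h x = ?h z}) U =
        ?P (U \<inter> {x. ?h x = ?h z}) / ?P {x. ?h x = ?h z}"
      by (rule measure_cond_pmf)
    show "?P {x. ?h x = ?h z} \<noteq> 0" using ne by (simp only: measure_pmf_zero_iff not_False_eq_True)
  qed
  have sets: "{x. ?f x \<in> U \<and> ?g x \<in> W \<and> ?h x = c} = (?f -` U \<inter> ?g -` W) \<inter> {x. ?h x = c}"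
    "{x. ?f x \<in> U \<and> ?h x = c} = ?f -` U \<inter> {x. ?h x = c}"
    "{x. ?g x \<in> W \<and> ?h x = c} = ?g -` W \<inter> {x. ?h x = c}" for U W c
    by auto
  show "ci p ?f ?g ?h" if ind: "cond_indep p A B C"
    unfolding ci_def
  proof (intro allI)
    fix U W c
    show "?P {x. ?f x \<in> U \<and> ?g x \<in> W \<and> ?h x = c} * ?P {x. ?h x = c} =
        ?P {x. ?f x \<in> U \<and> ?h x = c} * ?P {x. ?g x \<in> W \<and> ?h x = c}"
    proof (cases "\<exists>z\<in>set_pmf p. c = ?h z")
      case True
      then obtain z where z: "z \<in> set_pmf p" and c: "c = ?h z" by blast
      let ?M = "measure_pmf (cond_pmf p {x. ?h x = ?h z})"
      have "prob_space.indep_var ?M (count_space UNIV) ?f (count_space UNIV) ?g"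
        using ind z by (auto simp: cond_indep_def)
      then have "measure ?M ((\<lambda>x. (?f x, ?g x)) -` (U \<times> W) \<inter> space ?M) =
          measure ?M (?f -` U \<inter> space ?M) * measure ?M (?g -` W \<inter> space ?M)"
        by (rule prob_space.indep_varD[OF prob_space_measure_pmf]) simp_all
      moreover have "(\<lambda>x. (?f x, ?g x)) -` (U \<times> W) = ?f -` U \<inter> ?g -` W" by auto
      ultimately have "measure ?M (?f -` U \<inter> ?g -` W) = measure ?M (?f -` U) * measure ?M (?g -` W)"
        by simp
      then show ?thesis
        unfolding sets c cond[OF z] using pos[OF z] by (simp add: field_simps)
    next
      case False
      have "?P {x. ?h x = c} = ?P {x. False}"
        by (rule prob_cong_supp) (use False in blast)
      then have z: "?P {x. ?h x = c} = 0" by simp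
      show ?thesis using prob_eq_0_mono[OF z, of "\<lambda>x. ?f x \<in> U \<and> ?h x = c"] z by simp
    qed
  qed
  show "cond_indep p A B C" if ci: "ci p ?f ?g ?h"
    unfolding cond_indep_def
  proof
    fix z assume z: "z \<in> set_pmf p"
    let ?M = "measure_pmf (cond_pmf p {x. ?h x = ?h z})"
    have "prob_space.indep_set ?M (sigma_sets (space ?M) {?f -` U \<inter> space ?M |U. U \<in> sets (count_space UNIV)})
        (sigma_sets (space ?M) {?g -` U \<inter> space ?M |U. U \<in> sets (count_space UNIV)})"
    proof (rule prob_space.indep_set_sigma_sets[OF prob_space_measure_pmf])
      show "prob_space.indep_set ?M {?f -` U \<inter> space ?M |U. U \<in> sets (count_space UNIV)}
          {?g -` U \<inter> space ?M |U. U \<in> sets (count_space UNIV)}"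
      proof (rule prob_space.indep_setI[OF prob_space_measure_pmf])
        fix a b
        assume "a \<in> {?f -` U \<inter> space ?M |U. U \<in> sets (count_space UNIV)}"
          and "b \<in> {?g -` U \<inter> space ?M |U. U \<in> sets (count_space UNIV)}"
        then obtain U W where a: "a = ?f -` U" and b: "b = ?g -` W" by auto
        show "measure ?M (a \<inter> b) = measure ?M a * measure ?M b"
          using ciD[OF ci, of U W "?h z"] pos[OF z] unfolding a b sets cond[OF z]
          by (simp add: field_simps)
      qed auto
      show "Int_stable {?f -` U \<inter> space ?M |U. U \<in> sets (count_space UNIV)}"
        by (rule Int_stableI) (clarsimp simp flip: vimage_Int, blast)
      show "Int_stable {?g -` U \<inter> space ?M |U. U \<in> sets (count_space UNIV)}"
        by (rule Int_stableI) (clarsimp simp flip: vimage_Int, blast)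
    qed
    then show "prob_space.indep_var ?M (count_space UNIV) ?f (count_space UNIV) ?g"
      unfolding prob_space.indep_var_eq[OF prob_space_measure_pmf] by simp
  qed
qed

section \<open>Events whose probability tends to one\<close>

lemma in_large_sample_limit_iff:
  "in_large_sample_limit p P \<longleftrightarrow>
     (\<lambda>m. measure_pmf.prob (replicate_pmf m p) {D. \<not> P D}) \<longlonglongrightarrow> 0"
proof -
  have "measure_pmf.prob q {D. \<not> P D} = 1 - measure_pmf.prob q {D. P D}" for q
    using measure_pmf.prob_compl[of "{D. P D}" q] by (simp add: Compl_eq_Diff_UNIV[symmetric] Collect_neg_eq)
  then show ?thesis
    unfolding in_large_sample_limit_def
    using tendsto_diff[of "\<lambda>_. 1 :: real" 1 sequentially "\<lambda>m. measure_pmf.prob (replicate_pmf m p) {D. P D}" 1]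
      tendsto_diff[of "\<lambda>_. 1 :: real" 1 sequentially "\<lambda>m. 1 - measure_pmf.prob (replicate_pmf m p) {D. P D}" 0]
    by auto
qed

lemma in_large_sample_limit_mono:
  assumes "in_large_sample_limit p P" "\<And>D. P D \<Longrightarrow> Q D"
  shows "in_large_sample_limit p Q"
  unfolding in_large_sample_limit_iff
proof (rule tendsto_sandwich[OF _ _ tendsto_const assms(1)[unfolded in_large_sample_limit_iff]])
  have "measure_pmf.prob q {D. \<not> Q D} \<le> measure_pmf.prob q {D. \<not> P D}" for q
    by (rule prob_le) (use assms(2) in blast)
  then show "\<forall>\<^sub>F m in sequentially. measure_pmf.prob (replicate_pmf m p) {D. \<not> Q D} \<le>
      measure_pmf.prob (replicate_pmf m p) {D. \<not> P D}"
    by simp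
qed simp

lemma in_large_sample_limit_conj:
  assumes "in_large_sample_limit p P" "in_large_sample_limit p Q"
  shows "in_large_sample_limit p (\<lambda>D. P D \<and> Q D)"
  unfolding in_large_sample_limit_iff
proof (rule tendsto_sandwich[OF _ _ tendsto_const])
  show "(\<lambda>m. measure_pmf.prob (replicate_pmf m p) {D. \<not> P D} +
      measure_pmf.prob (replicate_pmf m p) {D. \<not> Q D}) \<longlonglongrightarrow> 0"
    using tendsto_add[OF assms[unfolded in_large_sample_limit_iff]] by simp
  have "measure_pmf.prob q {D. \<not> (P D \<and> Q D)} \<le>
      measure_pmf.prob q {D. \<not> P D} + measure_pmf.prob q {D. \<not> Q D}" for q
  proof -
    have "{D. \<not> (P D \<and> Q D)} = {D. \<not> P D} \<union> {D. \<not> Q D}" by auto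
    then show ?thesis by (simp add: measure_Un_le)
  qed
  then show "\<forall>\<^sub>F m in sequentially. measure_pmf.prob (replicate_pmf m p) {D. \<not> (P D \<and> Q D)} \<le>
      measure_pmf.prob (replicate_pmf m p) {D. \<not> P D} + measure_pmf.prob (replicate_pmf m p) {D. \<not> Q D}"
    by simp
qed simp

lemma in_large_sample_limit_ball:
  assumes "finite I" "\<And>i. i \<in> I \<Longrightarrow> in_large_sample_limit p (P i)"
  shows "in_large_sample_limit p (\<lambda>D. \<forall>i\<in>I. P i D)"
  using assms
proof (induction I)
  case empty
  then show ?case by (simp add: in_large_sample_limit_def)
next
  case (insert i I)
  then show ?case using in_large_sample_limit_conj[of p "P i" "\<lambda>D. \<forall>i\<in>I. P i D"] by simp
qed

text \<open>Score equivalence is assumed only for data with values in \<open>Val\<close>; such data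
  occur almost surely.\<close>

lemma in_large_sample_limit_lists:
  assumes "set_pmf p \<subseteq> A"
  shows "in_large_sample_limit p (\<lambda>D. D \<in> lists A)"
proof -
  have "set_pmf (replicate_pmf m p) \<inter> {D. \<not> D \<in> lists A} = {}" for m
    using assms by (auto simp: set_replicate_pmf)
  then have "measure_pmf.prob (replicate_pmf m p) {D. \<not> D \<in> lists A} = 0" for m
    by (simp only: measure_pmf_zero_iff)
  then show ?thesis unfolding in_large_sample_limit_iff by simp
qed

section \<open>Equivalence classes as search states\<close>

lemma dag_classesE:
  assumes "c \<in> dag_classes"
  obtains G where "acyclic G" "c = {H. acyclic H \<and> dag_equiv G H}"
  using assms by (auto simp: dag_classes_def quotient_def)

lemma dag_class_exists:
  assumes "acyclic G"
  obtains c where "c \<in> dag_classes" "G \<in> c"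
proof (rule that)
  show "{H. acyclic H \<and> dag_equiv G H} \<in> dag_classes"
    using assms by (auto simp: dag_classes_def quotient_def)
qed (use assms dag_equiv_refl in blast)

lemma dag_class_acyclic: "c \<in> dag_classes \<Longrightarrow> G \<in> c \<Longrightarrow> acyclic G"
  by (auto elim: dag_classesE)

lemma dag_class_equiv: "c \<in> dag_classes \<Longrightarrow> G \<in> c \<Longrightarrow> H \<in> c \<Longrightarrow> dag_equiv G H"
  by (elim dag_classesE) (auto intro: dag_equiv_trans dag_equiv_sym)

lemma dag_class_closed: "c \<in> dag_classes \<Longrightarrow> G \<in> c \<Longrightarrow> acyclic H \<Longrightarrow> dag_equiv G H \<Longrightarrow> H \<in> c"
  by (elim dag_classesE) (auto intro: dag_equiv_trans)

lemma class_score_eq: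
  assumes "score_equivalent Val S" "D \<in> lists (Pi UNIV Val)" "c \<in> dag_classes" "G \<in> c"
  shows "class_score S D c = S G D"
proof -
  have "S H D = S G D" if "H \<in> c" for H
    using assms that dag_class_equiv[OF assms(3) that assms(4)] dag_class_acyclic[OF assms(3)]
    unfolding score_equivalent_def by blast
  then have "(\<lambda>G. S G D) ` c = {S G D}" using assms(4) by blast
  then show ?thesis by (simp add: class_score_def)
qed

lemma adjacent_insert_edge:
  assumes "c \<in> dag_classes" "d \<in> dag_classes" "G \<in> c" "insert (a, b) G \<in> d" "(a, b) \<notin> G"
  shows "adjacent_classes c d" "adjacent_classes d c"
proof -
  have "dag_le G (insert (a, b) G)" by (rule dag_le_subset) auto
  moreover have "card (insert (a, b) G) = card G + 1" using assms(5) by simp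
  ultimately show "adjacent_classes c d" "adjacent_classes d c"
    using assms(1-4) unfolding adjacent_classes_def by blast+
qed

section \<open>Edges whose addition or deletion raises the score\<close>

lemma not_includes_dependent_edge:
  fixes G :: "('v::finite \<times> 'v) set"
  assumes ac: "acyclic G" and fin: "finite (set_pmf p)" and comp: "composition_property p"
    and ninc: "\<not> dag_includes G p"
  obtains j i where "(j, i) \<notin> G" "acyclic (insert (j, i) G)" "\<not> cond_indep p {j} {i} (parents G i)"
proof -
  obtain r where r: "ranking G r" using acyclic_ranking[OF ac] .
  obtain i where i: "\<not> ci p (\<lambda>x. x i) (\<lambda>x. restrict x {u. r u < r i}) (\<lambda>x. restrict x (parents G i))"
    using dag_includesI[OF r fin] ninc by blast
  let ?A = "{u. r u < r i}" and ?S = "parents G i"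
  \<comment> \<open>The parents are removed from the predecessors because composition is stated for
    disjoint sets.\<close>
  have "\<not> cond_indep p {i} (?A - ?S) ?S"
  proof
    assume "cond_indep p {i} (?A - ?S) ?S"
    then have "ci p (\<lambda>x. restrict x {i}) (\<lambda>x. restrict x (?A - ?S)) (\<lambda>x. restrict x ?S)"
      by (simp add: cond_indep_iff_ci)
    then have "ci p (\<lambda>x. x i) (\<lambda>x. restrict x ?A) (\<lambda>x. restrict x ?S)"
      by (rule ci_map; unfold determines_def restrict_eq_iff prod.inject; blast)
    then show False using i by simp
  qed
  moreover have "i \<notin> ?S" using rankingD[OF r, of i i] by (auto simp: parents_def)
  ultimately obtain j where j: "j \<in> ?A - ?S" "\<not> cond_indep p {i} {j} ?S"
    using comp[unfolded composition_property_def, rule_format, of i "?A - ?S" ?S] by auto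
  show ?thesis
  proof (rule that)
    show "(j, i) \<notin> G" using j by (simp add: parents_def)
    have "ranking (insert (j, i) G) r" using r j by (auto simp: ranking_def)
    then show "acyclic (insert (j, i) G)" by (rule ranking_acyclic)
    show "\<not> cond_indep p {j} {i} ?S" using j(2) ci_sym unfolding cond_indep_iff_ci by blast
  qed
qed

text \<open>A ranking of the enlarged graph also ranks \<open>G\<close> and puts \<open>j\<close>
  among the predecessors of \<open>i\<close>.\<close>

lemma includes_cond_indep_edge:
  fixes G :: "('v::finite \<times> 'v) set"
  assumes "acyclic (insert (j, i) G)" "(j, i) \<notin> G" and inc: "dag_includes G p"
  shows "cond_indep p {j} {i} (parents G i)"
proof -
  obtain r where r: "ranking (insert (j, i) G) r" using acyclic_ranking[OF assms(1)] .
  then have rG: "ranking G r" and ji: "r j < r i" by (auto simp: ranking_def)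
  have "ci p (\<lambda>x. restrict x {i}) (\<lambda>x. restrict x {j}) (\<lambda>x. restrict x (parents G i))"
    by (rule ci_map[OF ranking_ci[OF rG inc, of i]]) (use ji in \<open>auto intro!: determinesI simp: restrict_eq_iff\<close>)
  then show ?thesis unfolding cond_indep_iff_ci by (rule ci_sym)
qed

text \<open>Among the finitely many reachable classes take one of highest score: if it were no local
  maximum, a best neighbour would be reachable and score higher.\<close>

lemma uges_output_exists: "\<exists>c. uges_output S D c0 c"
proof -
  let ?R = "{c. (uges_step S D)\<^sup>*\<^sup>* c0 c}"
  obtain c where c: "c \<in> ?R" and c_max: "\<And>d. d \<in> ?R \<Longrightarrow> class_score S D d \<le> class_score S D c"
  proof -
    have "Max (class_score S D ` ?R) \<in> class_score S D ` ?R"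
      by (rule Max_in) auto
    then obtain c where "c \<in> ?R" "class_score S D c = Max (class_score S D ` ?R)"
      by (elim imageE) simp
    then show ?thesis using that[of c] by simp
  qed
  have "local_maximum S D c"
  proof (rule ccontr)
    let ?N = "{d. adjacent_classes c d}"
    assume "\<not> local_maximum S D c"
    then obtain d where d: "adjacent_classes c d" "class_score S D c < class_score S D d"
      by (auto simp: local_maximum_def not_le)
    have "Max (class_score S D ` ?N) \<in> class_score S D ` ?N"
      by (rule Max_in) (use d in auto)
    then obtain e where e: "adjacent_classes c e" "class_score S D e = Max (class_score S D ` ?N)"
      by (elim imageE) simp
    have e_max: "class_score S D x \<le> class_score S D e" if "adjacent_classes c x" for x
      unfolding e(2) using that by (intro Max_ge) auto
    then have "uges_step S D c e"
      using e(1) less_le_trans[OF d(2) e_max[OF d(1)]] by (simp add: uges_step_def)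
    then have "e \<in> ?R" using c by (auto intro: rtranclp.rtrancl_into_rtrancl)
    then show False using c_max[of e] d e_max[OF d(1)] by simp
  qed
  then show ?thesis using c by (auto simp: uges_output_def)
qed

lemma uges_output_class:
  assumes "c0 \<in> dag_classes" "uges_output S D c0 c"
  shows "c \<in> dag_classes"
proof -
  have "(uges_step S D)\<^sup>*\<^sup>* c0 c" using assms(2) by (simp add: uges_output_def)
  then show ?thesis
    by (induction rule: rtranclp_induct) (use assms(1) in \<open>auto simp: uges_step_def adjacent_classes_def\<close>)
qed

text \<open>The deterministic core, for a fixed data set on which all comparisons of local
  consistency come out right.\<close>

lemma local_maximum_inclusion_optimal:
  fixes Val :: "'v::finite \<Rightarrow> 's set" and p :: "('v \<Rightarrow> 's) pmf"
  assumes fin: "finite (set_pmf p)" and comp: "composition_property p"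
    and equiv: "score_equivalent Val S" and D: "D \<in> lists (Pi UNIV Val)"
    and consistent: "\<And>G j i. acyclic G \<Longrightarrow> (j, i) \<notin> G \<Longrightarrow> acyclic (insert (j, i) G) \<Longrightarrow>
      (if cond_indep p {j} {i} (parents G i) then S (insert (j, i) G) D < S G D
       else S G D < S (insert (j, i) G) D)"
    and c: "c \<in> dag_classes" and max: "local_maximum S D c"
  shows "class_inclusion_optimal p c"
  unfolding class_inclusion_optimal_def
proof (intro conjI ballI)
  show "c \<in> dag_classes" by (rule c)
  fix G assume G: "G \<in> c"
  have ac: "acyclic G" by (rule dag_class_acyclic[OF c G])
  note score = class_score_eq[OF equiv D]
  have inc: "dag_includes G p"
  proof (rule ccontr)
    assume "\<not> dag_includes G p"
    then obtain j i where ji: "(j, i) \<notin> G" "acyclic (insert (j, i) G)"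
      "\<not> cond_indep p {j} {i} (parents G i)"
      by (rule not_includes_dependent_edge[OF ac fin comp])
    obtain d where d: "d \<in> dag_classes" "insert (j, i) G \<in> d" using dag_class_exists[OF ji(2)] .
    have "class_score S D d \<le> class_score S D c"
      using max adjacent_insert_edge(1)[OF c d(1) G d(2) ji(1)] by (simp add: local_maximum_def)
    then show False using consistent[OF ac ji(1,2)] ji(3) score[OF c G] score[OF d] by simp
  qed
  moreover have "\<not> (\<exists>G'. acyclic G' \<and> dag_less G' G \<and> dag_includes G' p)"
  proof
    assume "\<exists>G'. acyclic G' \<and> dag_less G' G \<and> dag_includes G' p"
    then obtain G' where G': "acyclic G'" "dag_less G' G" "dag_includes G' p" by blast
    obtain K a b where K: "acyclic K" "(a, b) \<notin> K" "acyclic (insert (a, b) K)"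
      "dag_equiv (insert (a, b) K) G" "dag_le G' K"
      using dag_less_edge_deletion[OF G'(1) ac G'(2)] .
    have "dag_includes K p" by (rule dag_le_transfer[OF G'(1) K(1,5) fin G'(3)])
    then have ind: "cond_indep p {a} {b} (parents K b)"
      by (rule includes_cond_indep_edge[OF K(3,2)])
    \<comment> \<open>The deletion starts from another member of the class of \<open>G\<close>, so
      the class of \<open>K\<close> is a neighbour of \<open>c\<close>.\<close>
    have K'c: "insert (a, b) K \<in> c"
      by (rule dag_class_closed[OF c G K(3) dag_equiv_sym[OF K(4)]])
    obtain d where d: "d \<in> dag_classes" "K \<in> d" using dag_class_exists[OF K(1)] .
    have "class_score S D d \<le> class_score S D c"
      using max adjacent_insert_edge(2)[OF d(1) c d(2) K'c K(2)] by (simp add: local_maximum_def)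
    then show False using consistent[OF K(1,2,3)] ind score[OF c K'c] score[OF d] by simp
  qed
  ultimately show "inclusion_optimal p G" using ac by (simp add: inclusion_optimal_def)
qed

theorem corollary5:
  fixes Val :: "'v::finite \<Rightarrow> 's set"
    and p :: "('v \<Rightarrow> 's) pmf"
    and S :: "('v, 's) score"
    and c0 :: "('v \<times> 'v) set set"
  assumes "\<And>i. finite (Val i)"
    and "distribution_on Val p"
    and "composition_property p"
    and "locally_consistent Val S"
    and "score_equivalent Val S"
    and "c0 \<in> dag_classes"
  shows "in_large_sample_limit p
           (\<lambda>D. (\<exists>c. uges_output S D c0 c) \<and>
                (\<forall>c. uges_output S D c0 c \<longrightarrow> class_inclusion_optimal p c))"
proof -
  have supp: "set_pmf p \<subseteq> Pi UNIV Val" using assms(2) by (simp add: distribution_on_def)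
  have "finite (PiE UNIV Val)" by (rule finite_PiE) (use assms(1) in auto)
  then have fin: "finite (set_pmf p)"
    using supp by (auto simp: PiE_UNIV_domain intro: finite_subset)
  \<comment> \<open>There are finitely many edge additions, so with probability tending to 1 all
    comparisons hold at once, whatever path the search takes.\<close>
  let ?T = "{(G :: ('v \<times> 'v) set, j, i). acyclic G \<and> (j, i) \<notin> G \<and> acyclic (insert (j, i) G)}"
  let ?ok = "\<lambda>(G, j, i) D. if cond_indep p {j} {i} (parents G i)
      then S (insert (j, i) G) D < S G D else S G D < S (insert (j, i) G) D"
  have "in_large_sample_limit p (\<lambda>D. \<forall>t\<in>?T. ?ok t D)"
  proof (rule in_large_sample_limit_ball)
    fix t assume "t \<in> ?T"
    then obtain G j i where t: "t = (G, j, i)"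
      and G: "acyclic G" "(j, i) \<notin> G" "acyclic (insert (j, i) G)" by blast
    show "in_large_sample_limit p (?ok t)"
      using assms(4)[unfolded locally_consistent_def, rule_format, OF assms(2) G]
      by (cases "cond_indep p {j} {i} (parents G i)") (simp_all add: t)
  qed simp
  from in_large_sample_limit_conj[OF this in_large_sample_limit_lists[OF supp]]
  show ?thesis
  proof (rule in_large_sample_limit_mono)
    fix D assume D: "(\<forall>t\<in>?T. ?ok t D) \<and> D \<in> lists (Pi UNIV Val)"
    have "class_inclusion_optimal p c" if out: "uges_output S D c0 c" for c
    proof (rule local_maximum_inclusion_optimal[OF fin assms(3,5)])
      show "D \<in> lists (Pi UNIV Val)" using D by blast
      show "c \<in> dag_classes" by (rule uges_output_class[OF assms(6) out])
      show "local_maximum S D c" using out by (simp add: uges_output_def)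
      fix G :: "('v \<times> 'v) set" and j i assume "acyclic G" "(j, i) \<notin> G" "acyclic (insert (j, i) G)"
      then show "if cond_indep p {j} {i} (parents G i) then S (insert (j, i) G) D < S G D
          else S G D < S (insert (j, i) G) D"
        using D by auto
    qed
    then show "(\<exists>c. uges_output S D c0 c) \<and> (\<forall>c. uges_output S D c0 c \<longrightarrow> class_inclusion_optimal p c)"
      using uges_output_exists by blast
  qed
qed

end
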